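(* Let $1\le p\le q$ and $k\ge 0$ be fixed integers, and for each integer $n\ge q$ let $\mu=(n-p)^p=(\underbrace{n-p,\ldots,n-p}_{p})$. Then $$\lim_{n\to\infty} n^{\frac{p^2-1}{2}}\,E^{p(n-p)+k,\,p}\Big(I_{\{\lambda\supseteq\mu\}}(\lambda)\prod_{\substack{(i,j)\in\lambda\\ n-q<j\le n-p}}h^{\lambda}_{ij}\Big)=\frac{\sqrt p\,\prod_{j=1}^p (q-j)!}{(\sqrt{2\pi})^{p-1}\,k!}\;E\Big(\big(\tfrac12 Z_{2pq}\big)^k\Big),$$ where $Z_{2pq}$ is a chi-square random variable of parameter $2pq$. Consequently, as $n\to\infty$, $$E^{p(n-p)+k,\,p}\Big(I_{\{\lambda\supseteq\mu\}}(\lambda)\prod_{\substack{(i,j)\in\lambda\\ n-q<j\le n-p}}h^{\lambda}_{ij}\Big)\simeq c_{p,q,k}\,n^{-\frac{p^2-1}{2}},\qquad c_{p,q,k}:=\frac{\sqrt p\,\prod_{j=1}^p (q-j)!}{(\sqrt{2\pi})^{p-1}}\binom{pq-1+k}{k},$$ where $\simeq$ means that the ratio of the two sides tends to $1$.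
   Context: For a partition $\lambda$, $|\lambda|$ is its weight, $\lambda^\top$ the dual (conjugate) partition, so that $\lambda_1^\top$ is the number of nonzero parts of $\lambda$; $(i,j)\in\lambda$ means that the box in row $i$, column $j$ belongs to the Young diagram of $\lambda$ (i.e. $1\le j\le\lambda_i$); $\lambda\supseteq\mu$ means $\lambda_i\ge\mu_i$ for all $i$. The hook length of a box is $h^\lambda_{ij}=\lambda_i+\lambda_j^\top-i-j+1$. An empty product equals $1$. For integers $\ell\ge 0$, $p\ge 1$, $P^{\ell,p}$ is the probability measure on partitions $\lambda$ of weight $\ell$ given by $$P^{\ell,p}(\lambda)=\frac{f^\lambda\,\mathbf s_\lambda(1^p)}{p^{\ell}},$$ where $f^\lambda$ is the number of standard Young tableaux of shape $\lambda$ and $\mathbf s_\lambda(1^p)$ is the Schur polynomial evaluated at $p$ ones and zeros elsewhere, i.e. the number of semi-standard tableaux of shape $\lambda$ with entries in $\{1,\ldots,p\}$ (so it is zero unless $\lambda_1^\top\le p$). Equivalently, $P^{\ell,p}$ is the law of the RSK shape of a uniformly random word of length $\ell$ in the alphabet $\{1,\ldots,p\}$. $E^{\ell,p}$ denotes expectation with respect to $P^{\ell,p}$. The chi-square distribution of parameter $m$ is the law of $Z_m=\sum_{i=1}^m X_i^2$ with $X_1,\dots,X_m$ independent standard normal $N(0,1)$ random variables. *)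

theory Defs
  imports "HOL-Probability.Probability" "HOL-Library.Landau_Symbols"
begin

text \<open>
  A partition is a function on \<open>nat\<close> whose parts are its values at the indices \<open>1, 2, \<dots>\<close>;
  the unused value at \<open>0\<close> is fixed to be \<open>0\<close>, so that equality of partitions is equality of
  functions and containment of Young diagrams is the pointwise order \<open>\<le>\<close> on functions.
\<close>

definition is_partition :: "(nat \<Rightarrow> nat) \<Rightarrow> bool" where
  "is_partition la \<longleftrightarrow>
     la 0 = 0 \<and> (\<forall>i j. 1 \<le> i \<and> i \<le> j \<longrightarrow> la j \<le> la i) \<and> finite {i. la i \<noteq> 0}"

definition weight :: "(nat \<Rightarrow> nat) \<Rightarrow> nat" where
  "weight la = (\<Sum>i | la i \<noteq> 0. la i)"

definition partitions_of :: "nat \<Rightarrow> (nat \<Rightarrow> nat) set" where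
  "partitions_of l = {la. is_partition la \<and> weight la = l}"

definition conj_part :: "(nat \<Rightarrow> nat) \<Rightarrow> nat \<Rightarrow> nat" where
  "conj_part la j = (if j = 0 then 0 else card {i. 1 \<le> i \<and> j \<le> la i})"

definition diagram :: "(nat \<Rightarrow> nat) \<Rightarrow> (nat \<times> nat) set" where
  "diagram la = {(i, j). 1 \<le> i \<and> 1 \<le> j \<and> j \<le> la i}"

definition hook :: "(nat \<Rightarrow> nat) \<Rightarrow> nat \<times> nat \<Rightarrow> int" where
  "hook la = (\<lambda>(i, j). int (la i) + int (conj_part la j) - int i - int j + 1)"

definition rectangle :: "nat \<Rightarrow> nat \<Rightarrow> nat \<Rightarrow> nat" where
  "rectangle p m = (\<lambda>i. if 1 \<le> i \<and> i \<le> p then m else 0)"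

text \<open>Tableaux are \<open>undefined\<close> off the diagram, so that each filling is counted once.\<close>

definition standard_tableaux :: "(nat \<Rightarrow> nat) \<Rightarrow> (nat \<times> nat \<Rightarrow> nat) set" where
  "standard_tableaux la = {T \<in> extensional (diagram la).
     bij_betw T (diagram la) {1..weight la} \<and>
     (\<forall>i j j'. (i, j) \<in> diagram la \<and> (i, j') \<in> diagram la \<and> j < j' \<longrightarrow> T (i, j) < T (i, j')) \<and>
     (\<forall>i i' j. (i, j) \<in> diagram la \<and> (i', j) \<in> diagram la \<and> i < i' \<longrightarrow> T (i, j) < T (i', j))}"

definition semistandard_tableaux :: "(nat \<Rightarrow> nat) \<Rightarrow> nat \<Rightarrow> (nat \<times> nat \<Rightarrow> nat) set" where
  "semistandard_tableaux la p = {T \<in> diagram la \<rightarrow>\<^sub>E {1..p}.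
     (\<forall>i j j'. (i, j) \<in> diagram la \<and> (i, j') \<in> diagram la \<and> j < j' \<longrightarrow> T (i, j) \<le> T (i, j')) \<and>
     (\<forall>i i' j. (i, j) \<in> diagram la \<and> (i', j) \<in> diagram la \<and> i < i' \<longrightarrow> T (i, j) < T (i', j))}"

text \<open>The value of the Schur polynomial in \<open>p\<close> variables at the point \<open>(x 1, \<dots>, x p)\<close>.\<close>

definition schur :: "(nat \<Rightarrow> nat) \<Rightarrow> nat \<Rightarrow> (nat \<Rightarrow> real) \<Rightarrow> real" where
  "schur la p x = (\<Sum>T\<in>semistandard_tableaux la p. \<Prod>b\<in>diagram la. x (T b))"

definition shape_prob :: "nat \<Rightarrow> nat \<Rightarrow> (nat \<Rightarrow> nat) \<Rightarrow> real" where
  "shape_prob l p la = real (card (standard_tableaux la)) * schur la p (\<lambda>_. 1) / real p ^ l"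

definition shape_measure :: "nat \<Rightarrow> nat \<Rightarrow> (nat \<Rightarrow> nat) measure" where
  "shape_measure l p = point_measure (partitions_of l) (\<lambda>la. ennreal (shape_prob l p la))"

abbreviation shape_expectation :: "nat \<Rightarrow> nat \<Rightarrow> ((nat \<Rightarrow> nat) \<Rightarrow> real) \<Rightarrow> real" where
  "shape_expectation l p g \<equiv> integral\<^sup>L (shape_measure l p) g"

text \<open>
  The expectation in the statement; the truncated subtractions are the integer ones as soon as
  \<open>p \<le> q \<le> n\<close>, so they do not matter for the behaviour as \<open>n\<close> tends to infinity.
\<close>

definition hook_expectation :: "nat \<Rightarrow> nat \<Rightarrow> nat \<Rightarrow> nat \<Rightarrow> real" where
  "hook_expectation p q k n = shape_expectation (p * (n - p) + k) p
     (\<lambda>la. indicator {la. rectangle p (n - p) \<le> la} la *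
       (\<Prod>(i, j) | (i, j) \<in> diagram la \<and> n - q < j \<and> j \<le> n - p. of_int (hook la (i, j))))"

text \<open>
  The law of \<open>Z\<^sub>m\<close>, with the independent standard normal variables realised as the coordinates
  of the product space; \<open>chi_square_eqI\<close> below covers every other realisation.
\<close>

definition chi_square :: "nat \<Rightarrow> real measure" where
  "chi_square m =
     distr (\<Pi>\<^sub>M i\<in>{1..m}. density lborel (\<lambda>x. ennreal (std_normal_density x))) borel
       (\<lambda>x. \<Sum>i\<in>{1..m}. (x i)\<^sup>2)"

lemma schur_ones: "schur la p (\<lambda>_. 1) = real (card (semistandard_tableaux la p))"
  by (simp add: schur_def)

lemma shape_prob_nonneg: "0 \<le> shape_prob l p la"
  by (simp add: shape_prob_def schur_ones)

lemma finite_partitions_of: "finite (partitions_of l)"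
proof (rule finite_subset)
  show "finite {la. \<forall>i. (i \<in> {..l} \<longrightarrow> la i \<in> {..l}) \<and> (i \<notin> {..l} \<longrightarrow> la i = (0::nat))}"
    by (rule finite_set_of_finite_funs) auto
  show "partitions_of l \<subseteq>
      {la. \<forall>i. (i \<in> {..l} \<longrightarrow> la i \<in> {..l}) \<and> (i \<notin> {..l} \<longrightarrow> la i = (0::nat))}"
  proof (intro subsetI CollectI allI conjI impI)
    fix la i assume la: "la \<in> partitions_of l"
    let ?S = "{i. la i \<noteq> 0}"
    have fin: "finite ?S" and w: "sum la ?S = l"
      and dec: "\<And>i j. 1 \<le> i \<Longrightarrow> i \<le> j \<Longrightarrow> la j \<le> la i"
      using la by (auto simp: partitions_of_def is_partition_def weight_def)
    have "la i \<le> l"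
      using w member_le_sum[OF _ _ fin, of i la] by (cases "la i = 0") auto
    then show "la i \<in> {..l}" by simp
    assume i: "i \<notin> {..l}"
    show "la i = 0"
    proof (rule ccontr)
      assume nz: "la i \<noteq> 0"
      have pos: "0 < la j" if "j \<in> {1..i}" for j
        using dec[of j i] nz that by auto
      have "i = (\<Sum>j\<in>{1..i}. 1)" by simp
      also have "\<dots> \<le> sum la {1..i}" using pos by (intro sum_mono) (simp add: Suc_le_eq)
      also have "\<dots> \<le> sum la ?S" using fin pos by (intro sum_mono2) auto
      finally show False using w i by simp
    qed
  qed
qed

lemma shape_expectation_eq_sum:
  "shape_expectation l p g = (\<Sum>la\<in>partitions_of l. shape_prob l p la * g la)"
  unfolding shape_measure_def
  by (subst lebesgue_integral_point_measure_finite)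
     (auto simp: finite_partitions_of shape_prob_nonneg)

lemma (in prob_space) chi_square_eqI:
  assumes m: "1 \<le> m"
    and X: "indep_vars (\<lambda>_. borel) X {1..m}"
    and N: "\<And>i. i \<in> {1..m} \<Longrightarrow> distributed M lborel (X i) (\<lambda>x. ennreal (std_normal_density x))"
  shows "distr M borel (\<lambda>w. \<Sum>i\<in>{1..m}. (X i w)\<^sup>2) = chi_square m"
proof -
  let ?N = "density lborel (\<lambda>x. ennreal (std_normal_density x))"
  have rv: "random_variable borel (X i)" if "i \<in> {1..m}" for i
    using X that by (auto simp: indep_vars_def)
  have ne: "{1..m} \<noteq> {}" using m by auto
  have law: "distr M borel (X i) = ?N" if "i \<in> {1..m}" for i
  proof -
    have "distr M borel (X i) = distr M lborel (X i)"
      by (rule distr_cong) auto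
    also have "\<dots> = ?N" using N[OF that] by (simp add: distributed_def)
    finally show ?thesis .
  qed
  have "distr M (\<Pi>\<^sub>M i\<in>{1..m}. borel) (\<lambda>w. \<lambda>i\<in>{1..m}. X i w)
      = (\<Pi>\<^sub>M i\<in>{1..m}. distr M borel (X i))"
    using indep_vars_iff_distr_eq_PiM'[where X = X and I = "{1..m}" and M' = "\<lambda>_. borel", OF ne rv] X by simp
  also have "\<dots> = (\<Pi>\<^sub>M i\<in>{1..m}. ?N)"
    by (intro PiM_cong law refl)
  finally have PiM: "distr M (\<Pi>\<^sub>M i\<in>{1..m}. borel) (\<lambda>w. \<lambda>i\<in>{1..m}. X i w)
      = (\<Pi>\<^sub>M i\<in>{1..m}. ?N)" .
  have meas: "(\<lambda>w. \<lambda>i\<in>{1..m}. X i w) \<in> measurable M (\<Pi>\<^sub>M i\<in>{1..m}. borel)"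
    by (intro measurable_restrict rv)
  have "chi_square m = distr (distr M (\<Pi>\<^sub>M i\<in>{1..m}. borel) (\<lambda>w. \<lambda>i\<in>{1..m}. X i w)) borel
      (\<lambda>x. \<Sum>i\<in>{1..m}. (x i)\<^sup>2)"
    unfolding chi_square_def PiM ..
  also have "\<dots> = distr M borel
      ((\<lambda>x. \<Sum>i\<in>{1..m}. (x i)\<^sup>2) \<circ> (\<lambda>w. \<lambda>i\<in>{1..m}. X i w))"
    by (rule distr_distr[OF _ meas]) measurable
  also have "\<dots> = distr M borel (\<lambda>w. \<Sum>i\<in>{1..m}. (X i w)\<^sup>2)"
    by (rule distr_cong) auto
  finally show ?thesis ..
qed

end

theory Submission
  imports Defs "HOL-Real_Asymp.Real_Asymp" "Jordan_Normal_Form.Determinant"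
begin

text \<open>
  A partition \<open>la\<close> with at most \<open>p\<close> parts is encoded by the numbers \<open>x r = la (p - r) + r\<close>,
  \<open>r < p\<close>, and \<open>V\<close> denotes their Vandermonde determinant. Both tableau counts are multiples of \<open>V\<close>:
  for standard tableaux by removing the box with the largest entry, for semistandard ones by
  removing the boxes with entry \<open>p\<close>. The partitions containing the rectangle are the
  \<open>la + rectangle\<close> with \<open>la\<close> a partition of \<open>k\<close>, and \<open>V\<close> does not see the shift, so the expectation
  is a finite sum over partitions of \<open>k\<close> whose dependence on \<open>n\<close> is a multinomial coefficient,
  which Stirling's formula controls. What remains is
  \<open>S k = (\<Sum>la. V\<^sup>2 * (\<Prod>r. (x r + q - p)! / (x r)!))\<close>. The two identities
  \<open>(\<Sum>r. x r * V (x - e r)) = k * V x\<close> and \<open>(\<Sum>r. (x r + c) * V (x + e r)) = (k + p * (p - 1) + p * c) * V x\<close>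
  give \<open>(k + 1) * S (k + 1) = (p * q + k) * S k\<close>, the recursion of the chi-square moments.
\<close>

section \<open>Vandermonde determinants\<close>

text \<open>Kept as a determinant rather than as a product of differences: the identities below come
  from row and column operations and from the Leibniz expansion.\<close>

definition vandermonde_det :: "nat \<Rightarrow> (nat \<Rightarrow> real) \<Rightarrow> real" where
  "vandermonde_det p x = Determinant.det (mat p p (\<lambda>(i, j). x i ^ j))"

lemma det_mat_leibniz:
  "Determinant.det (mat p p f) =
     (\<Sum>s | s permutes {..<p}. signof s * (\<Prod>i<p. f (i, s i)))"
proof -
  have "(\<Prod>i = 0..<p. mat p p f $$ (i, s i)) = (\<Prod>i<p. f (i, s i))" if "s permutes {..<p}" for s
  proof -
    have "s i < p" if "i < p" for i
      using permutes_in_image[OF \<open>s permutes {..<p}\<close>, of i] that by simp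
    then show ?thesis by (intro prod.cong) auto
  qed
  then show ?thesis
    by (simp add: Determinant.det_def atLeast0LessThan)
qed

lemma vandermonde_det_cong:
  assumes "\<And>i. i < p \<Longrightarrow> x i = y i"
  shows "vandermonde_det p x = vandermonde_det p y"
  unfolding vandermonde_det_def using assms by (intro arg_cong[where f = Determinant.det] eq_matI) auto

lemma vandermonde_det_eq_0:
  assumes "i < p" "j < p" "i \<noteq> j" "x i = x j"
  shows "vandermonde_det p x = 0"
  unfolding vandermonde_det_def
  using assms by (intro det_identical_rows[of _ p i j]) auto

text \<open>Expanding each \<open>P j\<close> in powers factors the matrix as the Vandermonde matrix
  times the coefficient matrix \<open>?C\<close>, which is upper triangular with ones on the
  diagonal.\<close>

lemma det_monic_polys:
  assumes deg: "\<And>j. j < p \<Longrightarrow> degree (P j) = j" and lc: "\<And>j. j < p \<Longrightarrow> coeff (P j) j = 1"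
  shows "Determinant.det (mat p p (\<lambda>(i, j). poly (P j) (x i))) = vandermonde_det p x"
proof -
  let ?C = "mat p p (\<lambda>(k, j). coeff (P j) k)" and ?V = "mat p p (\<lambda>(i, j). x i ^ j)"
  have "mat p p (\<lambda>(i, j). poly (P j) (x i)) = ?V * ?C"
  proof (rule eq_matI)
    fix i j assume "i < dim_row (?V * ?C)" "j < dim_col (?V * ?C)"
    then have i: "i < p" and j: "j < p" by auto
    have "(?V * ?C) $$ (i, j) = (\<Sum>k<p. x i ^ k * coeff (P j) k)"
      using i j by (simp add: scalar_prod_def atLeast0LessThan)
    also have "\<dots> = (\<Sum>k\<le>j. x i ^ k * coeff (P j) k)"
      using j deg[OF j] by (intro sum.mono_neutral_right) (auto intro: coeff_eq_0)
    also have "\<dots> = poly (P j) (x i)"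
      by (simp add: poly_altdef deg[OF j] mult.commute)
    finally show "mat p p (\<lambda>(i, j). poly (P j) (x i)) $$ (i, j) = (?V * ?C) $$ (i, j)"
      using i j by simp
  qed auto
  moreover have "Determinant.det ?C = prod_list (diag_mat ?C)"
    by (rule det_upper_triangular[of _ p]) (auto simp: upper_triangular_def deg intro!: coeff_eq_0)
  moreover have "\<dots> = 1"
    by (simp add: prod_list_diag_prod lc)
  ultimately show ?thesis
    by (simp add: det_mult[of _ p] vandermonde_det_def)
qed

text \<open>The powers \<open>(y + c) ^ j\<close> are monic of degree \<open>j\<close> in
  \<open>y\<close>. This invariance is why adding a rectangle to a partition does not change its
  Vandermonde factor.\<close>

lemma vandermonde_det_shift: "vandermonde_det p (\<lambda>i. x i + c) = vandermonde_det p x"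
proof -
  have "Determinant.det (mat p p (\<lambda>(i, j). poly ([:c, 1:] ^ j) (x i))) = vandermonde_det p x"
    using coeff_linear_power[of c] by (intro det_monic_polys) (auto simp: degree_linear_power)
  then show ?thesis
    by (simp add: vandermonde_det_def add.commute)
qed

text \<open>The nodes are free: \<open>c m = t * m\<close> serves the step identity, while
  \<open>c m = - m\<close> gives falling factorials and hence binomial coefficients.\<close>

lemma det_newton_basis:
  "Determinant.det (mat p p (\<lambda>(i, j). \<Prod>m<j. x i + c m)) = vandermonde_det p x"
proof -
  have "Determinant.det (mat p p (\<lambda>(i, j). poly (\<Prod>m<j. [:c m, 1:]) (x i))) = vandermonde_det p x"
  proof (rule det_monic_polys)
    fix j :: nat
    show d: "degree (\<Prod>m<j. [:c m, 1:]) = j"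
      by (subst degree_prod_eq_sum_degree) auto
    have "lead_coeff (\<Prod>m<j. [:c m, 1:]) = 1"
      by (simp add: lead_coeff_prod)
    then show "coeff (\<Prod>m<j. [:c m, 1:]) j = 1" by (simp only: d)
  qed
  then show ?thesis by (simp add: poly_prod add.commute)
qed

text \<open>
  The Newton basis with step \<open>t\<close>, \<open>\<phi> j y = (\<Prod>m<j. y + t * m)\<close>, diagonalises the shift:
  \<open>y * \<phi> j (y + t) = (y + t * j) * \<phi> j y\<close>.
\<close>

lemma sum_vandermonde_det_step:
  "(\<Sum>i<p. x i * vandermonde_det p (x(i := x i + t))) =
     ((\<Sum>i<p. x i) + t * (\<Sum>i<p. real i)) * vandermonde_det p x"
proof -
  define \<phi> where "\<phi> j y = (\<Prod>m<j. y + t * real m)" for j :: nat and y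
  have \<phi>: "y * \<phi> j (y + t) = (y + t * real j) * \<phi> j y" for j y
  proof -
    have "y * \<phi> j (y + t) = (\<Prod>m<Suc j. y + t * real m)"
      unfolding \<phi>_def by (subst prod.lessThan_Suc_shift) (simp add: algebra_simps)
    then show ?thesis by (simp add: \<phi>_def)
  qed
  have V: "vandermonde_det p z =
      (\<Sum>s | s permutes {..<p}. signof s * (\<Prod>i<p. \<phi> (s i) (z i)))" for z
    unfolding det_newton_basis[symmetric, of p z "\<lambda>m. t * real m"] det_mat_leibniz \<phi>_def by simp
  have "(\<Sum>i<p. x i * (\<Prod>k<p. \<phi> (s k) ((x(i := x i + t)) k)))
      = ((\<Sum>i<p. x i) + t * (\<Sum>i<p. real i)) * (\<Prod>i<p. \<phi> (s i) (x i))"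
    if s: "s permutes {..<p}" for s
  proof -
    have "x i * (\<Prod>k<p. \<phi> (s k) ((x(i := x i + t)) k))
        = (x i + t * real (s i)) * (\<Prod>k<p. \<phi> (s k) (x k))" if "i < p" for i
    proof -
      have "(\<Prod>k<p. \<phi> (s k) ((x(i := x i + t)) k))
          = \<phi> (s i) (x i + t) * (\<Prod>k\<in>{..<p} - {i}. \<phi> (s k) (x k))"
        using that by (subst prod.remove[of _ i]) (auto intro!: prod.cong)
      moreover have "(\<Prod>k<p. \<phi> (s k) (x k)) = \<phi> (s i) (x i) * (\<Prod>k\<in>{..<p} - {i}. \<phi> (s k) (x k))"
        using that by (subst prod.remove[of _ i]) auto
      ultimately show ?thesis
        by (simp only: mult.assoc[symmetric] \<phi>)
    qed
    then have "(\<Sum>i<p. x i * (\<Prod>k<p. \<phi> (s k) ((x(i := x i + t)) k)))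
        = (\<Sum>i<p. (x i + t * real (s i)) * (\<Prod>k<p. \<phi> (s k) (x k)))" by simp
    also have "\<dots> = ((\<Sum>i<p. x i) + t * (\<Sum>i<p. real (s i))) * (\<Prod>k<p. \<phi> (s k) (x k))"
      by (simp add: sum_distrib_right[symmetric] sum.distrib sum_distrib_left)
    \<comment> \<open>As \<open>s\<close> is a permutation, the scalar is the same for every
      \<open>s\<close>, so it factors out of the Leibniz sum.\<close>
    also have "(\<Sum>i<p. real (s i)) = (\<Sum>i<p. real i)"
      using sum.permute[OF s, of real] by (simp add: o_def)
    finally show ?thesis .
  qed
  then show ?thesis
    unfolding V sum_distrib_left
    by (subst sum.swap) (simp add: sum_distrib_left[symmetric] mult.left_commute[of "x _"]
        mult.left_commute[of "_ + _"])
qed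

text \<open>Up to \<open>fact j\<close> the binomial coefficient is a falling factorial, a Newton
  polynomial. Every Leibniz term uses each column once, so the factorials leave as one common
  factor.\<close>

lemma det_binomial:
  "Determinant.det (mat p p (\<lambda>(i, j). real (x i choose j)))
     = vandermonde_det p (\<lambda>i. real (x i)) / (\<Prod>j<p. fact j)"
proof -
  have b: "real (a choose j) = (\<Prod>m<j. real a + - real m) / fact j" for a j
    by (simp add: binomial_gbinomial gbinomial_prod_rev atLeast0LessThan)
  have "(\<Prod>i<p. real (x i choose s i))
      = (\<Prod>i<p. \<Prod>m<s i. real (x i) + - real m) / (\<Prod>j<p. fact j)"
    if s: "s permutes {..<p}" for s
    using prod.permute[OF s, of "fact :: nat \<Rightarrow> real"] by (simp add: b prod_dividef o_def)
  then show ?thesis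
    unfolding det_newton_basis[symmetric, of p "\<lambda>i. real (x i)" "\<lambda>m. - real m"] det_mat_leibniz
      sum_divide_distrib by simp
qed

text \<open>The binomial matrix at \<open>x i = i\<close> is lower triangular with unit diagonal.
  The staircase encodes the empty partition, which makes this the base case for standard tableaux
  and for the Cauchy sum.\<close>

lemma vandermonde_det_staircase: "vandermonde_det p real = (\<Prod>j<p. fact j)"
proof -
  let ?B = "mat p p (\<lambda>(i, j). real (i choose j))"
  have "Determinant.det ?B = prod_list (diag_mat ?B)"
    by (rule det_lower_triangular[of p]) auto
  also have "\<dots> = 1" by (simp add: prod_list_diag_prod)
  finally show ?thesis using det_binomial[of p "\<lambda>i. i"] by (simp add: field_simps)
qed

text \<open>The hockey-stick identity: by Pascal's rule the sum telescopes.\<close>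

lemma sum_choose_interval:
  assumes "a \<le> b"
  shows "(\<Sum>m = a..<b. real (m choose j)) = real (b choose Suc j) - real (a choose Suc j)"
  using assms by (induction rule: dec_induct) (simp_all add: sum.atLeastLessThan_Suc)

text \<open>Subtracting from each row its predecessor turns column 0, all of whose entries are 1,
  into a unit vector. The entries of the remaining minor are hockey-stick sums, and expanding every
  row multilinearly gives determinants of size \<open>p\<close>. This mirrors the branching of
  semistandard tableaux.\<close>

lemma det_binomial_branching:
  assumes l: "\<And>r. r < p \<Longrightarrow> l r \<le> l (Suc r)"
  shows "Determinant.det (mat (Suc p) (Suc p) (\<lambda>(i, j). real (l i choose j)))
    = (\<Sum>m\<in>(\<Pi>\<^sub>E r\<in>{..<p}. {l r..<l (Suc r)}).
         Determinant.det (mat p p (\<lambda>(i, j). real (m i choose j))))"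
proof -
  \<comment> \<open>Row 0 is kept and the other rows are consecutive differences; multiplication by
    \<open>?L\<close> sums them back.\<close>
  define d where "d r j = (case r of 0 \<Rightarrow> real (l 0 choose j)
    | Suc r \<Rightarrow> real (l (Suc r) choose j) - real (l r choose j))" for r j
  let ?L = "mat (Suc p) (Suc p) (\<lambda>(i, k). if k \<le> i then 1 else (0 :: real))"
  let ?A = "mat (Suc p) (Suc p) (\<lambda>(r, j). d r j)"
  have tele: "(\<Sum>k\<le>i. d k j) = real (l i choose j)" for i j
    by (induction i) (simp_all add: d_def)
  have "mat (Suc p) (Suc p) (\<lambda>(i, j). real (l i choose j)) = ?L * ?A"
  proof (rule eq_matI)
    fix i j assume "i < dim_row (?L * ?A)" "j < dim_col (?L * ?A)"
    then have i: "i < Suc p" and j: "j < Suc p" by auto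
    have "(?L * ?A) $$ (i, j) = (\<Sum>k<Suc p. (if k \<le> i then 1 else 0) * d k j)"
      using i j by (simp add: scalar_prod_def atLeast0LessThan del: sum.lessThan_Suc)
    also have "\<dots> = (\<Sum>k\<le>i. d k j)"
      using i by (intro sum.mono_neutral_cong_right) auto
    finally show "mat (Suc p) (Suc p) (\<lambda>(i, j). real (l i choose j)) $$ (i, j) = (?L * ?A) $$ (i, j)"
      using i j by (simp add: tele)
  qed auto
  moreover have "Determinant.det ?L = 1"
    by (subst det_lower_triangular[of "Suc p"]) (auto simp: prod_list_diag_prod)
  ultimately have "Determinant.det (mat (Suc p) (Suc p) (\<lambda>(i, j). real (l i choose j)))
      = Determinant.det ?A"
    by (simp add: det_mult[of _ "Suc p"])
  also have "\<dots> = (\<Sum>i<Suc p. ?A $$ (i, 0) * cofactor ?A i 0)"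
    by (rule laplace_expansion_column) auto
  also have "\<dots> = cofactor ?A 0 0"
    by (subst sum.lessThan_Suc_shift) (simp add: d_def)
  also have "\<dots> = Determinant.det (mat p p (\<lambda>(r, j). d (Suc r) (Suc j)))"
    unfolding cofactor_def by (auto simp: mat_delete_def intro!: arg_cong[where f = Determinant.det])
  also have "\<dots> = (\<Sum>s | s permutes {..<p}. signof s *
      (\<Prod>i<p. \<Sum>m = l i..<l (Suc i). real (m choose s i)))"
    unfolding det_mat_leibniz
    by (intro sum.cong refl arg_cong2[where f = "(*)"] prod.cong) (simp_all add: d_def sum_choose_interval l)
  also have "\<dots> = (\<Sum>s | s permutes {..<p}. \<Sum>m\<in>(\<Pi>\<^sub>E r\<in>{..<p}. {l r..<l (Suc r)}).
      signof s * (\<Prod>i<p. real (m i choose s i)))"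
    by (simp add: prod_sum_PiE sum_distrib_left)
  also have "\<dots> = (\<Sum>m\<in>(\<Pi>\<^sub>E r\<in>{..<p}. {l r..<l (Suc r)}).
      Determinant.det (mat p p (\<lambda>(i, j). real (m i choose j))))"
    unfolding det_mat_leibniz by (subst sum.swap) simp
  finally show ?thesis .
qed

section \<open>Standard tableaux\<close>

text \<open>The usual beta numbers \<open>la i + p - i\<close>, indexed from row \<open>p\<close>
  upwards by \<open>r = p - i\<close>. For a partition they increase strictly with \<open>r\<close>,
  and for the empty one they are 0, ..., p - 1.\<close>

definition beta_number :: "nat \<Rightarrow> (nat \<Rightarrow> nat) \<Rightarrow> nat \<Rightarrow> nat" where
  "beta_number p la r = la (p - r) + r"

definition bounded_partitions :: "nat \<Rightarrow> nat \<Rightarrow> (nat \<Rightarrow> nat) set" where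
  "bounded_partitions p k = {la \<in> partitions_of k. \<forall>i>p. la i = 0}"

definition corners :: "(nat \<Rightarrow> nat) \<Rightarrow> nat set" where
  "corners la = {i. 1 \<le> i \<and> la (Suc i) < la i}"

section \<open>Partitions with at most \<open>p\<close> rows, and moves of a single box\<close>

lemma bounded_partitionsD:
  assumes "la \<in> bounded_partitions p k"
  shows "is_partition la" "weight la = k" "la 0 = 0" "i > p \<Longrightarrow> la i = 0"
    "1 \<le> i \<Longrightarrow> i \<le> j \<Longrightarrow> la j \<le> la i" "finite {i. la i \<noteq> 0}"
  using assms by (auto simp: bounded_partitions_def partitions_of_def is_partition_def)

lemma finite_bounded_partitions: "finite (bounded_partitions p k)"
  unfolding bounded_partitions_def using finite_partitions_of by simp

lemma weight_eq_sum:
  assumes "la 0 = 0" "\<And>i. i > p \<Longrightarrow> la i = 0"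
  shows "weight la = (\<Sum>i\<in>{1..p}. la i)"
  unfolding weight_def
proof (rule sum.mono_neutral_left)
  show "{i. la i \<noteq> 0} \<subseteq> {1..p}"
  proof
    fix i assume "i \<in> {i. la i \<noteq> 0}"
    then have "i \<noteq> 0" "\<not> i > p" using assms by (auto intro: gr0I)
    then show "i \<in> {1..p}" by auto
  qed
qed auto

lemma sum_fun_upd_nat:
  fixes f :: "'a \<Rightarrow> nat"
  assumes "finite A" "i \<in> A"
  shows "sum (f(i := v)) A + f i = sum f A + v"
proof -
  have "sum (f(i := v)) (A - {i}) = sum f (A - {i})" by (rule sum.cong) auto
  then show ?thesis using sum.remove[OF assms, of f] sum.remove[OF assms, of "f(i := v)"] by simp
qed

lemma bounded_partitionsI:
  assumes "la 0 = 0" "\<And>i j. 1 \<le> i \<Longrightarrow> i \<le> j \<Longrightarrow> la j \<le> la i" "\<And>i. i > p \<Longrightarrow> la i = 0"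
    and "(\<Sum>i\<in>{1..p}. la i) = k"
  shows "la \<in> bounded_partitions p k"
proof -
  have "{i. la i \<noteq> 0} \<subseteq> {..p}" using assms(3) by (auto simp: not_less[symmetric])
  then have "finite {i. la i \<noteq> 0}" by (rule finite_subset) simp
  then show ?thesis
    using assms weight_eq_sum[of la p]
    by (auto simp: bounded_partitions_def partitions_of_def is_partition_def)
qed

lemma sum_reverse: "(\<Sum>r<p. f (p - r)) = (\<Sum>i\<in>{1..p}. f i)" for f :: "nat \<Rightarrow> 'a :: comm_monoid_add"
  by (rule sum.reindex_bij_witness[of _ "\<lambda>i. p - i" "\<lambda>r. p - r"]) auto

lemma prod_reverse: "(\<Prod>r<p. f (p - r)) = (\<Prod>i\<in>{1..p}. f i)" for f :: "nat \<Rightarrow> 'a :: comm_monoid_mult"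
  by (rule prod.reindex_bij_witness[of _ "\<lambda>i. p - i" "\<lambda>r. p - r"]) auto

lemma sum_beta_number:
  assumes "la \<in> bounded_partitions p k"
  shows "(\<Sum>r<p. beta_number p la r) = k + (\<Sum>r<p. r)"
  using weight_eq_sum[of la p] bounded_partitionsD[OF assms] sum_reverse[of la p]
  by (simp add: beta_number_def sum.distrib)

lemma beta_number_upd:
  assumes "1 \<le> i" "i \<le> p"
  shows "beta_number p (la(i := v)) = (beta_number p la)(p - i := v + (p - i))"
  using assms by (auto simp: beta_number_def fun_eq_iff)

lemma remove_corner:
  assumes la: "la \<in> bounded_partitions p (Suc k)" and i: "i \<in> corners la"
  shows "la(i := la i - 1) \<in> bounded_partitions p k" "i \<le> p"
proof -
  note D = bounded_partitionsD[OF la]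
  have i1: "1 \<le> i" "la (Suc i) < la i" using i by (auto simp: corners_def)
  show ip: "i \<le> p" using D(4)[of i] i1 by (cases "i \<le> p") auto
  show "la(i := la i - 1) \<in> bounded_partitions p k"
  proof (rule bounded_partitionsI)
    fix a b :: nat assume ab: "1 \<le> a" "a \<le> b"
    have "la b \<le> la (Suc i)" if "b \<noteq> i" "i \<le> b" using that D(5)[of "Suc i" b] by simp
    then show "(la(i := la i - 1)) b \<le> (la(i := la i - 1)) a"
      using D(5)[OF ab] i1 ab by (cases "b = i"; cases "a = i") auto
  next
    have "(\<Sum>j\<in>{1..p}. la j) = Suc k" using weight_eq_sum[of la p] D by simp
    then show "(\<Sum>j\<in>{1..p}. (la(i := la i - 1)) j) = k"
      using i1 ip sum_fun_upd_nat[of "{1..p}" i la "la i - 1"] by simp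
  qed (use D i1 in auto)
qed

lemma add_box:
  assumes la: "la \<in> bounded_partitions p k" and i: "1 \<le> i" "i \<le> p" "i = 1 \<or> la i < la (i - 1)"
  shows "la(i := la i + 1) \<in> bounded_partitions p (Suc k)"
proof -
  note D = bounded_partitionsD[OF la]
  show ?thesis
  proof (rule bounded_partitionsI)
    fix a b :: nat assume ab: "1 \<le> a" "a \<le> b"
    have "la (i - 1) \<le> la a" if "a \<noteq> i" "a \<le> i" using that D(5)[of a "i - 1"] ab by simp
    then show "(la(i := la i + 1)) b \<le> (la(i := la i + 1)) a"
      using D(5)[OF ab] i ab by (cases "b = i"; cases "a = i") auto
  next
    have "(\<Sum>j\<in>{1..p}. la j) = k" using weight_eq_sum[of la p] D by simp
    then show "(\<Sum>j\<in>{1..p}. (la(i := la i + 1)) j) = Suc k"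
      using i sum_fun_upd_nat[of "{1..p}" i la "la i + 1"] by simp
  qed (use D i in auto)
qed

section \<open>Branching of standard tableaux at the largest entry\<close>

lemma finite_diagram:
  assumes "is_partition la"
  shows "finite (diagram la)"
proof -
  have "finite (Sigma {i. la i \<noteq> 0} (\<lambda>i. {..la i}))"
    using assms by (auto simp: is_partition_def)
  then show ?thesis by (rule finite_subset[rotated]) (auto simp: diagram_def)
qed

lemma finite_standard_tableaux: "is_partition la \<Longrightarrow> finite (standard_tableaux la)"
  by (rule finite_subset[OF _ finite_PiE[of "diagram la" "\<lambda>_. {1..weight la}"]])
     (auto simp: standard_tableaux_def finite_diagram PiE_def bij_betw_def)

text \<open>A box to the right of the largest entry, or below it, would have to carry a larger
  one.\<close>

lemma max_entry_at_corner:
  assumes la: "is_partition la" and w: "weight la = Suc w" and T: "T \<in> standard_tableaux la"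
  obtains i where "i \<in> corners la" "T (i, la i) = Suc w"
proof -
  have bij: "bij_betw T (diagram la) {1..Suc w}"
    and row: "\<And>i j j'. (i, j) \<in> diagram la \<Longrightarrow> (i, j') \<in> diagram la \<Longrightarrow> j < j' \<Longrightarrow> T (i, j) < T (i, j')"
    and col: "\<And>i i' j. (i, j) \<in> diagram la \<Longrightarrow> (i', j) \<in> diagram la \<Longrightarrow> i < i' \<Longrightarrow> T (i, j) < T (i', j)"
    using T w by (auto simp: standard_tableaux_def)
  have le: "T b \<le> Suc w" if "b \<in> diagram la" for b
    using bij_betwE[OF bij] that by auto
  have "Suc w \<in> T ` diagram la" using bij by (simp add: bij_betw_def)
  then obtain i j where ij: "(i, j) \<in> diagram la" "T (i, j) = Suc w" by auto
  have "j = la i"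
  proof (rule ccontr)
    assume "j \<noteq> la i"
    then have "(i, Suc j) \<in> diagram la" using ij(1) by (auto simp: diagram_def)
    then show False using row[OF ij(1), of "Suc j"] le[of "(i, Suc j)"] ij(2) by simp
  qed
  moreover have "la (Suc i) < la i"
  proof (rule ccontr)
    assume "\<not> la (Suc i) < la i"
    then have "(Suc i, j) \<in> diagram la" using ij(1) by (auto simp: diagram_def)
    then show False using col[OF ij(1), of "Suc i"] le[of "(Suc i, j)"] ij(2) by simp
  qed
  ultimately show ?thesis using that[of i] ij by (auto simp: diagram_def corners_def)
qed

text \<open>Deleting the corner box is inverted by writing \<open>Suc w\<close> into it. The result
  is again standard because all other entries are at most \<open>w\<close> and no box lies to the
  right of the corner or below it.\<close>

lemma card_standard_tableaux_fiber:
  assumes la: "la \<in> bounded_partitions p (Suc w)" and i: "i \<in> corners la"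
  shows "card {T \<in> standard_tableaux la. T (i, la i) = Suc w}
    = card (standard_tableaux (la(i := la i - 1)))"
proof -
  define mu where "mu = la(i := la i - 1)"
  define c where "c = (i, la i)"
  have w: "weight la = Suc w" "weight mu = w"
    using bounded_partitionsD(2)[OF la] bounded_partitionsD(2)[OF remove_corner(1)[OF la i]]
    by (simp_all add: mu_def)
  have i1: "1 \<le> i" "la (Suc i) < la i" using i by (auto simp: corners_def)
  have dec: "la j \<le> la (Suc i)" if "i < j" for j
    using bounded_partitionsD(5)[OF la, of "Suc i" j] that by simp
  have D: "diagram la = insert c (diagram mu)" "c \<notin> diagram mu"
    using i1 by (auto simp: diagram_def mu_def c_def split: if_splits)
  have "bij_betw (\<lambda>T. restrict T (diagram mu)) {T \<in> standard_tableaux la. T c = Suc w}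
      (standard_tableaux mu)"
  proof (rule bij_betw_byWitness[where f' = "\<lambda>S. S(c := Suc w)"])
    show "\<forall>T\<in>{T \<in> standard_tableaux la. T c = Suc w}. (restrict T (diagram mu))(c := Suc w) = T"
      by (auto simp: standard_tableaux_def D fun_eq_iff extensional_def)
    show "\<forall>S\<in>standard_tableaux mu. restrict (S(c := Suc w)) (diagram mu) = S"
      using D(2) by (auto simp: standard_tableaux_def fun_eq_iff extensional_def)
    show "(\<lambda>T. restrict T (diagram mu)) ` {T \<in> standard_tableaux la. T c = Suc w} \<subseteq> standard_tableaux mu"
    proof clarify
      fix T assume T: "T \<in> standard_tableaux la" "T c = Suc w"
      have "bij_betw T (insert c (diagram mu)) (insert (T c) {1..w})"
        using T w by (simp add: standard_tableaux_def D(1) atLeastAtMostSuc_conv)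
      then have "bij_betw T (diagram mu) {1..w}"
        using notIn_Un_bij_betw3[of c "diagram mu" T "{1..w}"] D(2) T(2) by simp
      then have "bij_betw (restrict T (diagram mu)) (diagram mu) {1..weight mu}"
        using w by (subst bij_betw_cong[of _ _ T]) auto
      then show "restrict T (diagram mu) \<in> standard_tableaux mu"
        using T(1) unfolding standard_tableaux_def D(1) by simp
    qed
    show "(\<lambda>S. S(c := Suc w)) ` standard_tableaux mu \<subseteq> {T \<in> standard_tableaux la. T c = Suc w}"
    proof clarify
      fix S assume S: "S \<in> standard_tableaux mu"
      let ?T = "S(c := Suc w)"
      have bij: "bij_betw S (diagram mu) {1..w}" using S w by (simp add: standard_tableaux_def)
      then have le: "S b \<le> w" if "b \<in> diagram mu" for b using bij_betwE that by force
      have "bij_betw ?T (diagram mu) {1..w}"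
        using bij D(2) by (subst bij_betw_cong[of _ _ S]) auto
      then have "bij_betw ?T (diagram mu \<union> {c}) ({1..w} \<union> {?T c})"
        using D(2) by (subst notIn_Un_bij_betw3[symmetric]) auto
      then have "bij_betw ?T (diagram la) {1..weight la}"
        by (simp add: D(1) w atLeastAtMostSuc_conv)
      moreover have "?T (r, j) < ?T (r, j')"
        if "(r, j) \<in> diagram la" "(r, j') \<in> diagram la" "j < j'" for r j j'
      proof -
        have "(r, j) \<in> diagram mu" using that D by (auto simp: c_def diagram_def mu_def)
        moreover have "(r, j') = c \<or> (r, j') \<in> diagram mu" using that D by auto
        ultimately show ?thesis
          using le[of "(r, j)"] S that D(2) by (auto simp: standard_tableaux_def less_Suc_eq_le)
      qed
      moreover have "?T (r, j) < ?T (r', j)"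
        if "(r, j) \<in> diagram la" "(r', j) \<in> diagram la" "r < r'" for r r' j
      proof -
        \<comment> \<open>Rows below the corner are shorter than \<open>la i\<close>, so the new
          largest entry is never the upper box of a column pair.\<close>
        have "(r, j) \<noteq> c" using that dec[of r'] i1 by (auto simp: c_def diagram_def)
        then have "(r, j) \<in> diagram mu" using that D by auto
        moreover have "(r', j) = c \<or> (r', j) \<in> diagram mu" using that D by auto
        ultimately show ?thesis
          using le[of "(r, j)"] S that D(2) by (auto simp: standard_tableaux_def less_Suc_eq_le)
      qed
      moreover have "?T \<in> extensional (diagram la)"
        using S by (auto simp: standard_tableaux_def extensional_def D(1))
      ultimately show "?T \<in> standard_tableaux la \<and> ?T c = Suc w"
        by (simp add: standard_tableaux_def)
    qed
  qed
  then show ?thesis unfolding mu_def c_def by (rule bij_betw_same_card)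
qed

lemma card_standard_tableaux_rec:
  assumes la: "la \<in> bounded_partitions p (Suc w)"
  shows "card (standard_tableaux la) = (\<Sum>i\<in>corners la. card (standard_tableaux (la(i := la i - 1))))"
proof -
  note D = bounded_partitionsD[OF la]
  let ?F = "\<lambda>i. {T \<in> standard_tableaux la. T (i, la i) = Suc w}"
  have "standard_tableaux la = (\<Union>i\<in>corners la. ?F i)"
    using max_entry_at_corner[OF D(1,2)] by blast
  moreover have "card (\<Union>i\<in>corners la. ?F i) = (\<Sum>i\<in>corners la. card (?F i))"
  proof (rule card_UN_disjoint)
    have "corners la \<subseteq> {..p}" using remove_corner(2)[OF la] by auto
    then show "finite (corners la)" by (rule finite_subset) simp
    show "\<forall>i\<in>corners la. finite (?F i)" using finite_standard_tableaux[OF D(1)] by simp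
    show "\<forall>i\<in>corners la. \<forall>j\<in>corners la. i \<noteq> j \<longrightarrow> ?F i \<inter> ?F j = {}"
    proof (intro ballI impI equals0I)
      fix i j T assume *: "i \<in> corners la" "j \<in> corners la" "i \<noteq> j" "T \<in> ?F i \<inter> ?F j"
      then have "inj_on T (diagram la)" by (auto simp: standard_tableaux_def bij_betw_def)
      moreover have "(i, la i) \<in> diagram la" "(j, la j) \<in> diagram la"
        using * by (auto simp: corners_def diagram_def)
      moreover have "T (i, la i) = T (j, la j)" using * by simp
      ultimately have "(i, la i) = (j, la j)" by (metis inj_onD)
      then show False using * by simp
    qed
  qed
  ultimately show ?thesis
    using card_standard_tableaux_fiber[OF la] by simp
qed

text \<open>If row \<open>i\<close> is not a corner, then either \<open>i = p\<close> and its beta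
  number is 0, or rows \<open>i\<close> and \<open>i + 1\<close> are equal and lowering the former
  makes two beta numbers coincide. Thus a sum over corners extends to all rows.\<close>

lemma removal_vanishes:
  assumes la: "la \<in> bounded_partitions p k" and i: "1 \<le> i" "i \<le> p" "i \<notin> corners la"
  shows "real (beta_number p la (p - i)) *
    vandermonde_det p ((\<lambda>r. real (beta_number p la r))(p - i := real (beta_number p la (p - i)) - 1)) = 0"
proof (cases "i = p")
  case True
  then have "la p = 0" using bounded_partitionsD(4)[OF la, of "Suc p"] i by (auto simp: corners_def)
  then show ?thesis using True by (simp add: beta_number_def)
next
  case False
  have "la (Suc i) = la i"
    using i bounded_partitionsD(5)[OF la, of i "Suc i"] by (auto simp: corners_def)
  moreover have "p - (p - Suc i) = Suc i" "p - i = Suc (p - Suc i)" "p - (p - i) = i"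
    using i False by auto
  ultimately have "real (beta_number p la (p - Suc i)) = real (beta_number p la (p - i)) - 1"
    by (simp add: beta_number_def)
  then show ?thesis
    using i False
    by (subst vandermonde_det_eq_0[of "p - i" _ "p - Suc i"]) auto
qed

text \<open>The step identity with \<open>t = - 1\<close>, after extending the sum to all rows;
  \<open>k\<close> is the excess of the beta numbers over the staircase.\<close>

lemma sum_removals:
  assumes la: "la \<in> bounded_partitions p k"
  defines "x \<equiv> \<lambda>r. real (beta_number p la r)"
  shows "(\<Sum>i\<in>corners la. x (p - i) * vandermonde_det p (x(p - i := x (p - i) - 1)))
    = real k * vandermonde_det p x"
proof -
  have "i \<le> p" if "i \<in> corners la" for i
    using bounded_partitionsD(4)[OF la, of i] that by (cases "i \<le> p") (auto simp: corners_def)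
  then have sub: "corners la \<subseteq> {1..p}" by (auto simp: corners_def)
  have "(\<Sum>i\<in>corners la. x (p - i) * vandermonde_det p (x(p - i := x (p - i) - 1)))
      = (\<Sum>i\<in>{1..p}. x (p - i) * vandermonde_det p (x(p - i := x (p - i) - 1)))"
    using sub removal_vanishes[OF la] unfolding x_def by (intro sum.mono_neutral_left) auto
  also have "\<dots> = (\<Sum>r<p. x r * vandermonde_det p (x(r := x r + - 1)))"
    by (subst sum_reverse[symmetric]) simp
  also have "\<dots> = ((\<Sum>r<p. x r) - (\<Sum>r<p. real r)) * vandermonde_det p x"
    by (subst sum_vandermonde_det_step) simp
  also have "(\<Sum>r<p. x r) - (\<Sum>r<p. real r) = real k"
    using sum_beta_number[OF la] by (simp add: x_def flip: of_nat_sum)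
  finally show ?thesis .
qed

lemma prod_beta_upd:
  fixes f :: "nat \<Rightarrow> 'a :: comm_monoid_mult"
  assumes "1 \<le> i" "i \<le> p"
  shows "(\<Prod>r<p. f (beta_number p (la(i := v)) r))
    = f (v + (p - i)) * (\<Prod>r\<in>{..<p} - {p - i}. f (beta_number p la r))"
  using assms by (subst prod.remove[of _ "p - i"]) (auto simp: beta_number_upd intro!: prod.cong)

text \<open>The Frobenius formula for the number of standard tableaux. Removing a corner lowers one
  beta number by 1, so its factorial releases exactly the weight \<open>x (p - i)\<close> that
  \<open>sum_removals\<close> needs.\<close>

lemma card_standard_tableaux:
  assumes "la \<in> bounded_partitions p k"
  shows "real (card (standard_tableaux la)) * (\<Prod>r<p. fact (beta_number p la r))
    = fact k * vandermonde_det p (\<lambda>r. real (beta_number p la r))"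
  using assms
proof (induction k arbitrary: la)
  case 0
  note D = bounded_partitionsD[OF 0]
  have "la = (\<lambda>_. 0)" using D(2,6) by (auto simp: weight_def fun_eq_iff)
  moreover from this have "diagram la = {}" "weight la = 0" by (auto simp: diagram_def weight_def)
  ultimately have "standard_tableaux la = {\<lambda>_. undefined}" "beta_number p la = (\<lambda>r. r)"
    by (auto simp: standard_tableaux_def beta_number_def bij_betw_def)
  then show ?case by (simp add: vandermonde_det_staircase)
next
  case (Suc k)
  let ?x = "\<lambda>r. real (beta_number p la r)"
  let ?F = "\<Prod>r<p. fact (beta_number p la r) :: real"
  have "real (card (standard_tableaux (la(i := la i - 1)))) * ?F
      = fact k * (?x (p - i) * vandermonde_det p (?x(p - i := ?x (p - i) - 1)))"
    if i: "i \<in> corners la" for i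
  proof -
    define mu where "mu = la(i := la i - 1)"
    have mu: "mu \<in> bounded_partitions p k" "i \<le> p"
      using remove_corner[OF Suc.prems i] by (simp_all add: mu_def)
    have i1: "1 \<le> i" "0 < la i" using i by (auto simp: corners_def)
    have b: "beta_number p la (p - i) = Suc (la i - 1 + (p - i))"
      using i1 mu(2) by (simp add: beta_number_def)
    have "?F = fact (beta_number p la (p - i)) * (\<Prod>r\<in>{..<p} - {p - i}. fact (beta_number p la r))"
      using i1 mu(2) by (subst prod.remove[of _ "p - i"]) auto
    also have "fact (beta_number p la (p - i)) = ?x (p - i) * (fact (la i - 1 + (p - i)) :: real)"
      by (simp add: b)
    finally have "?F = ?x (p - i) * (\<Prod>r<p. fact (beta_number p mu r))"
      using prod_beta_upd[OF i1(1) mu(2), where f = "fact :: nat \<Rightarrow> real" and la = la and v = "la i - 1"] by (simp add: mu_def)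
    moreover have "(\<lambda>r. real (beta_number p mu r)) = ?x(p - i := ?x (p - i) - 1)"
      using i1 mu(2) b by (auto simp: mu_def beta_number_upd fun_eq_iff)
    ultimately show ?thesis
      unfolding mu_def[symmetric] using Suc.IH[OF mu(1)] by (simp add: mult.left_commute)
  qed
  then have "real (card (standard_tableaux la)) * ?F
      = fact k * (\<Sum>i\<in>corners la. ?x (p - i) * vandermonde_det p (?x(p - i := ?x (p - i) - 1)))"
    by (simp add: card_standard_tableaux_rec[OF Suc.prems] sum_distrib_right sum_distrib_left)
  then show ?case using sum_removals[OF Suc.prems] by simp
qed

section \<open>Semistandard tableaux\<close>

lemma down_closed_eq_interval:
  fixes S :: "nat set"
  assumes "finite S" "0 \<notin> S" "\<And>a b. b \<in> S \<Longrightarrow> 1 \<le> a \<Longrightarrow> a \<le> b \<Longrightarrow> a \<in> S"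
  shows "S = {1..card S}"
proof (cases "S = {}")
  case False
  have "S = {1..Max S}"
  proof (intro equalityI subsetI)
    fix x assume "x \<in> S"
    then show "x \<in> {1..Max S}" using assms(1,2) by (cases x) auto
  next
    fix x assume "x \<in> {1..Max S}"
    then show "x \<in> S" using assms(3)[OF Max_in[OF assms(1) False]] by auto
  qed
  then show ?thesis by (metis card_atLeastAtMost diff_Suc_1)
qed simp

section \<open>Entries of semistandard tableaux and branching at the largest letter\<close>

lemma semistandard_tableauxD:
  assumes "T \<in> semistandard_tableaux la p"
  shows "b \<in> diagram la \<Longrightarrow> 1 \<le> T b" "b \<in> diagram la \<Longrightarrow> T b \<le> p"
    "b \<notin> diagram la \<Longrightarrow> T b = undefined"
    "(i, j) \<in> diagram la \<Longrightarrow> (i, j') \<in> diagram la \<Longrightarrow> j < j' \<Longrightarrow> T (i, j) \<le> T (i, j')"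
    "(i, j) \<in> diagram la \<Longrightarrow> (i', j) \<in> diagram la \<Longrightarrow> i < i' \<Longrightarrow> T (i, j) < T (i', j)"
proof -
  have "T \<in> diagram la \<rightarrow>\<^sub>E {1..p}" using assms by (simp add: semistandard_tableaux_def)
  then show "b \<in> diagram la \<Longrightarrow> 1 \<le> T b" "b \<in> diagram la \<Longrightarrow> T b \<le> p"
    "b \<notin> diagram la \<Longrightarrow> T b = undefined"
    using PiE_mem[of T "diagram la" "\<lambda>_. {1..p}" b] PiE_arb[of T "diagram la" "\<lambda>_. {1..p}" b] by auto
qed (use assms in \<open>simp_all add: semistandard_tableaux_def\<close>)

lemma semistandard_tableauxI:
  assumes "\<And>b. b \<in> diagram la \<Longrightarrow> 1 \<le> T b \<and> T b \<le> p" "\<And>b. b \<notin> diagram la \<Longrightarrow> T b = undefined"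
    "\<And>i j j'. (i, j) \<in> diagram la \<Longrightarrow> (i, j') \<in> diagram la \<Longrightarrow> j < j' \<Longrightarrow> T (i, j) \<le> T (i, j')"
    "\<And>i i' j. (i, j) \<in> diagram la \<Longrightarrow> (i', j) \<in> diagram la \<Longrightarrow> i < i' \<Longrightarrow> T (i, j) < T (i', j)"
  shows "T \<in> semistandard_tableaux la p"
proof -
  have "T \<in> diagram la \<rightarrow>\<^sub>E {1..p}" using assms(1,2) by (intro PiE_I) auto
  then show ?thesis using assms(3,4) by (simp add: semistandard_tableaux_def)
qed

text \<open>Going down a column the entries start at 1 or more and increase strictly. Hence entries
  at most \<open>p\<close> occupy only the first \<open>p\<close> rows.\<close>

lemma row_le_entry:
  assumes T: "T \<in> semistandard_tableaux la p" and dec: "\<And>i j. 1 \<le> i \<Longrightarrow> i \<le> j \<Longrightarrow> la j \<le> la i"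
    and "(i, j) \<in> diagram la"
  shows "i \<le> T (i, j)"
  using assms(3)
proof (induction i)
  case (Suc i)
  show ?case
  proof (cases "i = 0")
    case True
    then show ?thesis using Suc.prems semistandard_tableauxD(1)[OF T] by simp
  next
    case False
    then have "(i, j) \<in> diagram la"
      using Suc.prems dec[of i "Suc i"] by (auto simp: diagram_def)
    then have "i \<le> T (i, j)" "T (i, j) < T (Suc i, j)"
      using Suc semistandard_tableauxD(5)[OF T] by simp_all
    then show ?thesis by simp
  qed
qed (simp add: diagram_def)

lemma finite_semistandard_tableaux: "is_partition la \<Longrightarrow> finite (semistandard_tableaux la p)"
  by (rule finite_subset[OF _ finite_PiE[of "diagram la" "\<lambda>_. {1..p}"]])
     (auto simp: semistandard_tableaux_def finite_diagram)

lemma semistandard_tableaux_empty: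
  assumes "is_partition la" "la i \<noteq> 0" "p < i"
  shows "semistandard_tableaux la p = {}"
proof (rule equals0I)
  fix T assume T: "T \<in> semistandard_tableaux la p"
  have D: "(i, 1) \<in> diagram la" using assms by (auto simp: diagram_def Suc_le_eq)
  have "i \<le> T (i, 1)"
    using assms by (intro row_le_entry[OF T _ D]) (auto simp: is_partition_def)
  moreover have "T (i, 1) \<le> p" using semistandard_tableauxD(2)[OF T D] .
  ultimately show False using assms by simp
qed

text \<open>For \<open>la\<close> with at most \<open>p + 1\<close> rows these are the shapes
  \<open>nu\<close> with at most \<open>p\<close> rows for which \<open>la / nu\<close> is a
  horizontal strip. Values outside rows 1 to \<open>p\<close> are pinned to 0 so that each shape is
  one function.\<close>

definition interlacing :: "nat \<Rightarrow> (nat \<Rightarrow> nat) \<Rightarrow> (nat \<Rightarrow> nat) set" where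
  "interlacing p la = {nu. nu 0 = 0 \<and> (\<forall>i>p. nu i = 0) \<and> (\<forall>i\<in>{1..p}. la (Suc i) \<le> nu i \<and> nu i \<le> la i)}"

lemma interlacing_is_partition:
  assumes la: "is_partition la" and nu: "nu \<in> interlacing p la"
  shows "is_partition nu"
  unfolding is_partition_def
proof (intro conjI allI impI)
  show "nu 0 = 0" using nu by (simp add: interlacing_def)
  have "{i. nu i \<noteq> 0} \<subseteq> {..p}" using nu by (auto simp: interlacing_def not_less[symmetric])
  then show "finite {i. nu i \<noteq> 0}" by (rule finite_subset) simp
  fix i j :: nat assume ij: "1 \<le> i \<and> i \<le> j"
  show "nu j \<le> nu i"
  proof (cases "i = j \<or> p < j")
    case False
    then have "nu j \<le> la j" "la (Suc i) \<le> nu i" using nu ij by (auto simp: interlacing_def)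
    moreover have "la j \<le> la (Suc i)" using la ij False by (auto simp: is_partition_def)
    ultimately show ?thesis by simp
  qed (use nu in \<open>auto simp: interlacing_def\<close>)
qed

lemma diagram_eqD:
  assumes "diagram la = diagram mu" "la 0 = 0" "mu 0 = 0"
  shows "la = mu"
proof
  fix i
  have "{j. (i, j) \<in> diagram la} = {j. (i, j) \<in> diagram mu}" using assms by simp
  then show "la i = mu i"
  proof (cases "i = 0")
    case False
    then have "{j. (i, j) \<in> diagram ka} = {1..ka i}" for ka by (auto simp: diagram_def)
    then have "{1..la i} = {1..mu i}" using assms(1) by metis
    then show ?thesis by (metis card_atLeastAtMost diff_Suc_1)
  qed (use assms in simp)
qed

text \<open>Weakly increasing rows make the entries at most \<open>p\<close> an initial segment of
  each row. The box above any box has entry at most \<open>p\<close>, because columns increase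
  strictly; this gives the lower interlacing bound.\<close>

lemma semistandard_shape_of_small_entries:
  assumes la: "la \<in> bounded_partitions (Suc p) k" and T: "T \<in> semistandard_tableaux la (Suc p)"
  obtains nu where "nu \<in> interlacing p la" "\<And>b. b \<in> diagram nu \<longleftrightarrow> b \<in> diagram la \<and> T b \<le> p"
proof -
  note D = bounded_partitionsD[OF la]
  define S where "S i = {j. (i, j) \<in> diagram la \<and> T (i, j) \<le> p}" for i
  define nu where "nu i = card (S i)" for i
  note row = semistandard_tableauxD(4)[OF T] and col = semistandard_tableauxD(5)[OF T]
    and range = semistandard_tableauxD(2)[OF T]
  have sub: "S i \<subseteq> {1..la i}" for i by (auto simp: S_def diagram_def)
  then have fin: "finite (S i)" for i by (rule finite_subset) simp
  have S: "S i = {1..nu i}" for i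
    unfolding nu_def
  proof (rule down_closed_eq_interval[OF fin])
    show "0 \<notin> S i" using sub[of i] by auto
    fix a b assume ab: "b \<in> S i" "1 \<le> a" "a \<le> b"
    then have b: "(i, b) \<in> diagram la" "T (i, b) \<le> p" by (simp_all add: S_def)
    then have a: "(i, a) \<in> diagram la" using ab by (simp add: diagram_def)
    have "T (i, a) \<le> T (i, b)" using row[OF a b(1)] ab by (cases "a = b") simp_all
    then show "a \<in> S i" using a b by (simp add: S_def)
  qed
  have diag: "b \<in> diagram nu \<longleftrightarrow> b \<in> diagram la \<and> T b \<le> p" for b
  proof -
    obtain i j where b: "b = (i, j)" by (cases b)
    have "b \<in> diagram nu \<longleftrightarrow> 1 \<le> i \<and> j \<in> S i" unfolding S by (auto simp: b diagram_def)
    also have "\<dots> \<longleftrightarrow> b \<in> diagram la \<and> T b \<le> p" by (auto simp: S_def b diagram_def)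
    finally show ?thesis .
  qed
  have "S i = {}" if i: "i = 0 \<or> p < i" for i
  proof (rule equals0I)
    fix j assume "j \<in> S i"
    then have "(i, j) \<in> diagram la" "T (i, j) \<le> p" by (auto simp: S_def)
    moreover from this have "i \<le> T (i, j)" by (intro row_le_entry[OF T D(5)])
    ultimately show False using i by (auto simp: diagram_def)
  qed
  then have "nu i = 0" if "i = 0 \<or> p < i" for i using that by (simp add: nu_def)
  moreover have "la (Suc i) \<le> nu i \<and> nu i \<le> la i" if i: "i \<in> {1..p}" for i
  proof
    show "nu i \<le> la i" using card_mono[OF _ sub[of i]] by (simp add: nu_def)
    have "{1..la (Suc i)} \<subseteq> S i"
    proof
      fix j assume j: "j \<in> {1..la (Suc i)}"
      then have "(Suc i, j) \<in> diagram la" "(i, j) \<in> diagram la"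
        using i D(5)[of i "Suc i"] by (auto simp: diagram_def)
      then show "j \<in> S i" using col[of i j "Suc i"] range[of "(Suc i, j)"] by (auto simp: S_def)
    qed
    from card_mono[OF fin this] show "la (Suc i) \<le> nu i" by (simp add: nu_def)
  qed
  ultimately have "nu \<in> interlacing p la" by (simp add: interlacing_def)
  then show ?thesis using that diag by blast
qed

text \<open>Restriction to \<open>nu\<close> is inverted by filling the strip with
  \<open>Suc p\<close>. Interlacing puts at most one strip box in each column, so columns stay
  strict.\<close>

lemma card_semistandard_tableaux_fiber:
  assumes la: "la \<in> bounded_partitions (Suc p) k" and nu: "nu \<in> interlacing p la"
  shows "card {T \<in> semistandard_tableaux la (Suc p). \<forall>b. b \<in> diagram nu \<longleftrightarrow> b \<in> diagram la \<and> T b \<le> p}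
    = card (semistandard_tableaux nu p)"
proof -
  note D = bounded_partitionsD[OF la]
  let ?F = "{T \<in> semistandard_tableaux la (Suc p). \<forall>b. b \<in> diagram nu \<longleftrightarrow> b \<in> diagram la \<and> T b \<le> p}"
  let ?ext = "\<lambda>S b. if b \<in> diagram la - diagram nu then Suc p else S b"
  have nu_le1: "nu i \<le> la i" for i
    using nu by (cases "i = 0 \<or> p < i") (auto simp: interlacing_def)
  have nu_le2: "la (Suc i) \<le> nu i" if "1 \<le> i" "i \<le> p" for i
    using nu that by (simp add: interlacing_def)
  have sub: "diagram nu \<subseteq> diagram la" using nu_le1 by (auto simp: diagram_def intro: le_trans)
  have "bij_betw (\<lambda>T. restrict T (diagram nu)) ?F (semistandard_tableaux nu p)"
  proof (rule bij_betw_byWitness[where f' = ?ext])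
    show "\<forall>T\<in>?F. ?ext (restrict T (diagram nu)) = T"
    proof (intro ballI ext)
      fix T b assume "T \<in> ?F"
      then have T: "T \<in> semistandard_tableaux la (Suc p)"
        and iff: "b \<in> diagram nu \<longleftrightarrow> b \<in> diagram la \<and> T b \<le> p" by blast+
      show "?ext (restrict T (diagram nu)) b = T b"
        using iff semistandard_tableauxD(2,3)[OF T, of b] by (auto simp: le_Suc_eq)
    qed
    show "\<forall>S\<in>semistandard_tableaux nu p. restrict (?ext S) (diagram nu) = S"
    proof (intro ballI ext)
      fix S b assume "S \<in> semistandard_tableaux nu p"
      then show "restrict (?ext S) (diagram nu) b = S b"
        using semistandard_tableauxD(3)[of S nu p b] by auto
    qed
    show "(\<lambda>T. restrict T (diagram nu)) ` ?F \<subseteq> semistandard_tableaux nu p"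
    proof (intro image_subsetI semistandard_tableauxI)
      fix T assume "T \<in> ?F"
      then have T: "T \<in> semistandard_tableaux la (Suc p)"
        and iff: "\<And>b. b \<in> diagram nu \<longleftrightarrow> b \<in> diagram la \<and> T b \<le> p" by blast+
      let ?R = "restrict T (diagram nu)"
      show "1 \<le> ?R b \<and> ?R b \<le> p" if "b \<in> diagram nu" for b
        using that semistandard_tableauxD(1)[OF T, of b] iff[of b] by simp
      show "?R b = undefined" if "b \<notin> diagram nu" for b using that by simp
      show "?R (i, j) \<le> ?R (i, j')"
        if "(i, j) \<in> diagram nu" "(i, j') \<in> diagram nu" "j < j'" for i j j'
        using that sub semistandard_tableauxD(4)[OF T, of i j j'] by (simp add: subset_iff)
      show "?R (i, j) < ?R (i', j)"
        if "(i, j) \<in> diagram nu" "(i', j) \<in> diagram nu" "i < i'" for i i' j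
        using that sub semistandard_tableauxD(5)[OF T, of i j i'] by (simp add: subset_iff)
    qed
    show "?ext ` semistandard_tableaux nu p \<subseteq> ?F"
    proof (intro image_subsetI CollectI conjI semistandard_tableauxI allI)
      fix S assume S: "S \<in> semistandard_tableaux nu p"
      note range = semistandard_tableauxD(1,2)[OF S]
      show "1 \<le> ?ext S b" "?ext S b \<le> Suc p" if "b \<in> diagram la" for b
        using range[of b] that by auto
      show "?ext S b = undefined" if "b \<notin> diagram la" for b
        using semistandard_tableauxD(3)[OF S, of b] that sub by auto
      show "?ext S (i, j) \<le> ?ext S (i, j')"
        if "(i, j) \<in> diagram la" "(i, j') \<in> diagram la" "j < j'" for i j j'
      proof (cases "(i, j') \<in> diagram nu")
        case True
        then have "(i, j) \<in> diagram nu" using that by (auto simp: diagram_def)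
        then show ?thesis using True semistandard_tableauxD(4)[OF S, of i j j'] that by simp
      next
        case False
        then show ?thesis using that range(2)[of "(i, j)"] by (auto intro: le_SucI)
      qed
      show "?ext S (i, j) < ?ext S (i', j)"
        if "(i, j) \<in> diagram la" "(i', j) \<in> diagram la" "i < i'" for i i' j
      proof -
        have i: "1 \<le> i" "1 \<le> j" "j \<le> la i'" using that by (auto simp: diagram_def)
        then have "i' \<le> Suc p" using D(4)[of i'] by (cases "i' \<le> Suc p") auto
        \<comment> \<open>A box of \<open>la\<close> that has another box below it lies in
          \<open>nu\<close>.\<close>
        then have "la i' \<le> nu i"
          using D(5)[of "Suc i" i'] nu_le2[of i] that i by simp
        then have nu1: "(i, j) \<in> diagram nu" using i by (simp add: diagram_def)
        show ?thesis
        proof (cases "(i', j) \<in> diagram nu")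
          case True
          then show ?thesis using nu1 semistandard_tableauxD(5)[OF S, of i j i'] that by simp
        next
          case False
          then show ?thesis using nu1 that range(2)[OF nu1] by simp
        qed
      qed
      show "b \<in> diagram nu \<longleftrightarrow> b \<in> diagram la \<and> ?ext S b \<le> p" for b
        using sub range(2)[of b] by auto
    qed
  qed
  then show ?thesis by (rule bij_betw_same_card)
qed

lemma finite_interlacing: "finite (interlacing p la)"
proof -
  let ?m = "Max (la ` {..p})"
  have "interlacing p la \<subseteq> {nu. \<forall>i. (i \<in> {..p} \<longrightarrow> nu i \<in> {..?m}) \<and> (i \<notin> {..p} \<longrightarrow> nu i = 0)}"
  proof (intro subsetI CollectI allI conjI impI)
    fix nu i assume nu: "nu \<in> interlacing p la"
    show "nu i = 0" if "i \<notin> {..p}" using nu that by (auto simp: interlacing_def)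
    assume i: "i \<in> {..p}"
    then have "nu i \<le> la i" using nu by (cases "i = 0") (auto simp: interlacing_def)
    also have "\<dots> \<le> ?m" using i by (intro Max_ge) auto
    finally show "nu i \<in> {..?m}" by simp
  qed
  then show ?thesis by (rule finite_subset) (rule finite_set_of_finite_funs; simp)
qed

lemma card_semistandard_tableaux_rec:
  assumes la: "la \<in> bounded_partitions (Suc p) k"
  shows "card (semistandard_tableaux la (Suc p)) = (\<Sum>nu\<in>interlacing p la. card (semistandard_tableaux nu p))"
proof -
  note D = bounded_partitionsD[OF la]
  let ?F = "\<lambda>nu. {T \<in> semistandard_tableaux la (Suc p). \<forall>b. b \<in> diagram nu \<longleftrightarrow> b \<in> diagram la \<and> T b \<le> p}"
  have "semistandard_tableaux la (Suc p) = (\<Union>nu\<in>interlacing p la. ?F nu)"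
  proof (intro equalityI subsetI)
    fix T assume T: "T \<in> semistandard_tableaux la (Suc p)"
    then show "T \<in> (\<Union>nu\<in>interlacing p la. ?F nu)"
      using semistandard_shape_of_small_entries[OF la T] by (smt (verit) UN_I mem_Collect_eq)
  qed auto
  moreover have "card (\<Union>nu\<in>interlacing p la. ?F nu) = (\<Sum>nu\<in>interlacing p la. card (?F nu))"
  proof (rule card_UN_disjoint[OF finite_interlacing])
    show "\<forall>nu\<in>interlacing p la. finite (?F nu)" using finite_semistandard_tableaux[OF D(1)] by simp
    show "\<forall>nu\<in>interlacing p la. \<forall>nu'\<in>interlacing p la. nu \<noteq> nu' \<longrightarrow> ?F nu \<inter> ?F nu' = {}"
    proof (intro ballI impI equals0I)
      fix nu nu' T
      assume *: "nu \<in> interlacing p la" "nu' \<in> interlacing p la" "nu \<noteq> nu'" "T \<in> ?F nu \<inter> ?F nu'"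
      then have "diagram nu = diagram nu'" by blast
      then show False using * by (auto simp: interlacing_def dest!: diagram_eqD)
    qed
  qed
  ultimately show ?thesis
    using card_semistandard_tableaux_fiber[OF la] by simp
qed

text \<open>In beta numbers, with respect to \<open>p\<close> for \<open>nu\<close> and
  \<open>p + 1\<close> for \<open>la\<close>, the interlacing inequalities become independent
  half-open intervals, the index set of \<open>det_binomial_branching\<close>.\<close>

lemma bij_betw_interlacing:
  "bij_betw (\<lambda>nu. restrict (beta_number p nu) {..<p}) (interlacing p la)
     (\<Pi>\<^sub>E r\<in>{..<p}. {beta_number (Suc p) la r..<beta_number (Suc p) la (Suc r)})"
proof (rule bij_betw_byWitness[where f' = "\<lambda>m i. if 1 \<le> i \<and> i \<le> p then m (p - i) - (p - i) else 0"])
  let ?inv = "\<lambda>m i. if 1 \<le> i \<and> i \<le> p then m (p - i) - (p - i) else 0"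
  let ?P = "\<Pi>\<^sub>E r\<in>{..<p}. {beta_number (Suc p) la r..<beta_number (Suc p) la (Suc r)}"
  \<comment> \<open>This makes the truncated subtraction in \<open>?inv\<close> exact.\<close>
  have lower: "r \<le> m r" if "m \<in> ?P" "r < p" for m r
    using that by (force simp: PiE_iff beta_number_def)
  show "\<forall>nu\<in>interlacing p la. ?inv (restrict (beta_number p nu) {..<p}) = nu"
    by (auto simp: fun_eq_iff beta_number_def interlacing_def not_less_eq_eq)
  show "\<forall>m\<in>?P. restrict (beta_number p (?inv m)) {..<p} = m"
  proof (intro ballI ext)
    fix m r assume "m \<in> ?P"
    then show "restrict (beta_number p (?inv m)) {..<p} r = m r"
      using lower[of m r] by (cases "r < p") (auto simp: beta_number_def PiE_iff extensional_def)
  qed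
  show "(\<lambda>nu. restrict (beta_number p nu) {..<p}) ` interlacing p la \<subseteq> ?P"
  proof (intro image_subsetI PiE_I)
    fix nu r assume "nu \<in> interlacing p la" "r \<in> {..<p}"
    then have "la (Suc (p - r)) \<le> nu (p - r)" "nu (p - r) \<le> la (p - r)" "r < p"
      by (auto simp: interlacing_def)
    then show "restrict (beta_number p nu) {..<p} r
        \<in> {beta_number (Suc p) la r..<beta_number (Suc p) la (Suc r)}"
      by (simp add: beta_number_def Suc_diff_le)
  qed simp
  show "?inv ` ?P \<subseteq> interlacing p la"
  proof (intro image_subsetI)
    fix m assume m: "m \<in> ?P"
    have "la (Suc i) \<le> m (p - i) - (p - i) \<and> m (p - i) - (p - i) \<le> la i" if i: "1 \<le> i" "i \<le> p" for i
    proof -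
      have "m (p - i) \<in> {beta_number (Suc p) la (p - i)..<beta_number (Suc p) la (Suc (p - i))}"
        using m i by (auto simp: PiE_iff)
      moreover have "Suc p - (p - i) = Suc i" "Suc p - Suc (p - i) = i" using i by auto
      ultimately show ?thesis by (auto simp: beta_number_def)
    qed
    then show "?inv m \<in> interlacing p la" by (auto simp: interlacing_def)
  qed
qed

text \<open>The Weyl dimension formula. The induction runs on the binomial determinant, where the
  branching rule has no denominators and matches the recursion for tableaux term by term.\<close>

lemma card_semistandard_tableaux:
  assumes "la \<in> bounded_partitions p k"
  shows "real (card (semistandard_tableaux la p))
    = vandermonde_det p (\<lambda>r. real (beta_number p la r)) / (\<Prod>j<p. fact j)"
  unfolding det_binomial[symmetric]
  using assms
proof (induction p arbitrary: la k)
  case 0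
  then have "la = (\<lambda>_. 0)" by (auto simp: bounded_partitions_def partitions_of_def is_partition_def fun_eq_iff)
       (metis gr0I)
  then have "diagram la = {}" by (auto simp: diagram_def)
  then have "semistandard_tableaux la 0 = {\<lambda>_. undefined}"
    by (auto simp: semistandard_tableaux_def)
  then show ?case by (simp add: det_mat_leibniz)
next
  case (Suc p)
  note D = bounded_partitionsD[OF Suc.prems]
  let ?det = "\<lambda>p m. Determinant.det (mat p p (\<lambda>(i, j). real (m i choose j)))"
  have IH: "real (card (semistandard_tableaux nu p)) = ?det p (restrict (beta_number p nu) {..<p})"
    if nu: "nu \<in> interlacing p la" for nu
  proof -
    have "nu \<in> bounded_partitions p (weight nu)"
      using interlacing_is_partition[OF D(1) nu] nu
      by (simp add: bounded_partitions_def partitions_of_def interlacing_def)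
    from Suc.IH[OF this] show ?thesis
      by (auto intro!: arg_cong[where f = Determinant.det])
  qed
  have mono: "beta_number (Suc p) la r \<le> beta_number (Suc p) la (Suc r)" if "r < p" for r
  proof -
    have "la (Suc (p - r)) \<le> la (p - r)" using that by (intro D(5)) auto
    then show ?thesis using that by (simp add: beta_number_def Suc_diff_le)
  qed
  have "real (card (semistandard_tableaux la (Suc p)))
      = (\<Sum>nu\<in>interlacing p la. ?det p (restrict (beta_number p nu) {..<p}))"
    by (simp add: card_semistandard_tableaux_rec[OF Suc.prems] IH)
  also have "\<dots> = (\<Sum>m\<in>(\<Pi>\<^sub>E r\<in>{..<p}. {beta_number (Suc p) la r..<beta_number (Suc p) la (Suc r)}). ?det p m)"
    by (rule sum.reindex_bij_betw[OF bij_betw_interlacing])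
  also have "\<dots> = ?det (Suc p) (beta_number (Suc p) la)"
    by (intro det_binomial_branching[of p "beta_number (Suc p) la", symmetric] mono)
  finally show ?case .
qed

section \<open>The Cauchy sum over partitions of k\<close>

text \<open>Row 1 needs its own case because index 0 carries the dummy value 0.\<close>

definition addable :: "nat \<Rightarrow> (nat \<Rightarrow> nat) \<Rightarrow> nat set" where
  "addable p la = {i \<in> {1..p}. i = 1 \<or> la i < la (i - 1)}"

text \<open>Row \<open>i\<close> has the same length as the row above, so raising its beta number by
  1 makes the two coincide.\<close>

lemma addition_vanishes:
  assumes la: "la \<in> bounded_partitions p k" and i: "i \<in> {1..p}" "i \<notin> addable p la"
  shows "vandermonde_det p ((\<lambda>r. real (beta_number p la r))(p - i := real (beta_number p la (p - i)) + 1)) = 0"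
proof -
  have "la i = la (i - 1)" "2 \<le> i"
    using i bounded_partitionsD(5)[OF la, of "i - 1" i] by (auto simp: addable_def)
  moreover have "p - (p - (i - 1)) = i - 1" "p - (p - i) = i" "p - (i - 1) = Suc (p - i)"
    using i by auto
  ultimately have "real (beta_number p la (p - (i - 1))) = real (beta_number p la (p - i)) + 1"
    by (simp add: beta_number_def)
  then show ?thesis
    using i \<open>2 \<le> i\<close> by (subst vandermonde_det_eq_0[of "p - i" _ "p - (i - 1)"]) auto
qed

lemma sum_additions:
  assumes la: "la \<in> bounded_partitions p k"
  defines "x \<equiv> \<lambda>r. real (beta_number p la r)"
  shows "(\<Sum>i\<in>addable p la. (x (p - i) + 1 + real a) * vandermonde_det p (x(p - i := x (p - i) + 1)))
    = real (p * (p + a) + k) * vandermonde_det p x"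
proof -
  \<comment> \<open>The step identity needs the weight to be the variable itself; the shift turns
    the weight \<open>x + 1 + a\<close> into \<open>y\<close> and leaves the determinants
    unchanged.\<close>
  define y where "y r = x r + (1 + real a)" for r
  have shift: "vandermonde_det p (x(r := x r + 1)) = vandermonde_det p (y(r := y r + 1))" for r
  proof -
    have "(\<lambda>i. (x(r := x r + 1)) i + (1 + real a)) = y(r := y r + 1)"
      by (auto simp: y_def fun_eq_iff)
    then show ?thesis by (metis vandermonde_det_shift)
  qed
  have "(\<Sum>i\<in>addable p la. (x (p - i) + 1 + real a) * vandermonde_det p (x(p - i := x (p - i) + 1)))
      = (\<Sum>i\<in>{1..p}. (x (p - i) + 1 + real a) * vandermonde_det p (x(p - i := x (p - i) + 1)))"
    using addition_vanishes[OF la] unfolding x_def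
    by (intro sum.mono_neutral_left) (auto simp: addable_def)
  also have "\<dots> = (\<Sum>r<p. y r * vandermonde_det p (y(r := y r + 1)))"
    by (subst sum_reverse[symmetric]) (simp add: shift y_def add.assoc)
  also have "\<dots> = ((\<Sum>r<p. y r) + (\<Sum>r<p. real r)) * vandermonde_det p x"
    by (subst sum_vandermonde_det_step) (simp add: y_def[abs_def] vandermonde_det_shift)
  also have "(\<Sum>r<p. y r) + (\<Sum>r<p. real r) = real (p * (p + a) + k)"
  proof -
    have "(\<Sum>r<p. x r) = real k + (\<Sum>r<p. real r)"
      using sum_beta_number[OF la] by (simp add: x_def flip: of_nat_sum of_nat_add)
    moreover have "2 * (\<Sum>r<p. real r) = real p * real p - real p"
      by (induction p) (simp_all add: algebra_simps)
    ultimately show ?thesis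
      by (simp add: y_def sum.distrib algebra_simps)
  qed
  finally show ?thesis .
qed

text \<open>Up to a product of factorials depending only on \<open>p\<close> and \<open>a\<close>,
  this is the sum of the Schur values at \<open>p\<close> ones times those at \<open>p + a\<close>
  ones, the part of degree \<open>k\<close> of the Cauchy identity.\<close>

definition cauchy_sum :: "nat \<Rightarrow> nat \<Rightarrow> nat \<Rightarrow> real" where
  "cauchy_sum p a k = (\<Sum>la\<in>bounded_partitions p k.
     (vandermonde_det p (\<lambda>r. real (beta_number p la r)))\<^sup>2 *
     (\<Prod>r<p. fact (beta_number p la r + a) / fact (beta_number p la r)))"

text \<open>
  Removing a box from the first Vandermonde factor for \<open>k + 1\<close> is the same, after moving the box
  over to the second factor, as adding a box for \<open>k\<close>.
\<close>

lemma cauchy_sum_rec: "real (Suc k) * cauchy_sum p a (Suc k) = real (p * (p + a) + k) * cauchy_sum p a k"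
proof -
  let ?x = "\<lambda>la r. real (beta_number p la r)"
  let ?V = "\<lambda>la. vandermonde_det p (?x la)"
  let ?w = "\<lambda>x. fact (x + a) / fact x :: real"
  let ?G = "\<lambda>la. \<Prod>r<p. ?w (beta_number p la r)"
  have "real (Suc k) * cauchy_sum p a (Suc k)
      = (\<Sum>la\<in>bounded_partitions p (Suc k). ?V la * ?G la *
          (\<Sum>i\<in>corners la. ?x la (p - i) * vandermonde_det p ((?x la)(p - i := ?x la (p - i) - 1))))"
    unfolding cauchy_sum_def sum_distrib_left[of "real (Suc k)"]
    by (intro sum.cong refl) (simp only: sum_removals, simp add: power2_eq_square)
  also have "\<dots> = (\<Sum>(la, i)\<in>Sigma (bounded_partitions p (Suc k)) corners. ?V la * ?G la *
          (?x la (p - i) * vandermonde_det p ((?x la)(p - i := ?x la (p - i) - 1))))"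
  proof -
    have "finite (corners la)" if "la \<in> bounded_partitions p (Suc k)" for la
      by (rule finite_subset[of _ "{..p}"]) (use remove_corner(2)[OF that] in auto)
    then show ?thesis
      by (simp add: sum.Sigma[symmetric] finite_bounded_partitions sum_distrib_left)
  qed
  also have "\<dots> = (\<Sum>(la, i)\<in>Sigma (bounded_partitions p k) (addable p). ?V la * ?G la *
          ((?x la (p - i) + 1 + real a) * vandermonde_det p ((?x la)(p - i := ?x la (p - i) + 1))))"
  proof (rule sum.reindex_bij_witness[where i = "\<lambda>(la, i). (la(i := la i + 1), i)"
        and j = "\<lambda>(la, i). (la(i := la i - 1), i)"], goal_cases)
    case (1 b)
    then show ?case by (auto simp: corners_def)
  next
    case (2 b)
    then obtain la i where b: "b = (la, i)" and la: "la \<in> bounded_partitions p (Suc k)"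
      and i: "i \<in> corners la" by auto
    have "la i - 1 < la (i - 1)" if "i \<noteq> 1"
    proof -
      have "la i \<le> la (i - 1)" "0 < la i"
        using that i bounded_partitionsD(5)[OF la, of "i - 1" i] by (auto simp: corners_def)
      then show ?thesis by linarith
    qed
    then have "i \<in> addable p (la(i := la i - 1))"
      using i remove_corner(2)[OF la i] by (auto simp: corners_def addable_def)
    then show ?case using remove_corner(1)[OF la i] by (simp add: b)
  next
    case (3 b)
    then show ?case by auto
  next
    case (4 b)
    then obtain la i where b: "b = (la, i)" and la: "la \<in> bounded_partitions p k"
      and i: "i \<in> addable p la" by auto
    have "la (Suc i) \<le> la i"
      using i bounded_partitionsD(5)[OF la, of i "Suc i"] by (auto simp: addable_def)
    then show ?case
      using i add_box[OF la, of i] by (auto simp: b addable_def corners_def)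
  next
    case (5 b)
    then obtain la i where b: "b = (la, i)" and la: "la \<in> bounded_partitions p (Suc k)"
      and i: "i \<in> corners la" by auto
    define mu where "mu = la(i := la i - 1)"
    have i1: "1 \<le> i" "i \<le> p" "0 < la i" using i remove_corner(2)[OF la i] by (auto simp: corners_def)
    have la_mu: "la = mu(i := Suc (mu i))" using i1 by (auto simp: mu_def)
    have x: "?x la (p - i) = ?x mu (p - i) + 1"
      and x_la: "(?x mu)(p - i := ?x mu (p - i) + 1) = ?x la"
      and x_mu: "(?x la)(p - i := ?x la (p - i) - 1) = ?x mu"
      using i1 unfolding la_mu by (auto simp: beta_number_upd fun_eq_iff beta_number_def[of _ _ "p - i"])
    let ?R = "\<Prod>r\<in>{..<p} - {p - i}. ?w (beta_number p mu r)"
    let ?m = "beta_number p mu (p - i)"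
    have G_la: "?G la = ?w (Suc ?m) * ?R"
      using prod_beta_upd[OF i1(1,2), where f = ?w and la = mu and v = "Suc (mu i)"] i1
      by (simp add: la_mu[symmetric] beta_number_def[of _ _ "p - i"])
    have G_mu: "?G mu = ?w ?m * ?R"
      using prod_beta_upd[OF i1(1,2), where f = ?w and la = mu and v = "mu i"] i1
      by (simp add: beta_number_def[of _ _ "p - i"])
    \<comment> \<open>This ratio of consecutive weights turns the removal weight of
      \<open>la\<close> into the addition weight of \<open>mu\<close>.\<close>
    have w: "?w (Suc m) * (real m + 1) = (real m + 1 + real a) * ?w m" for m
      by (simp add: add_ac)
    have "?G la * ?x la (p - i) = (?w (Suc ?m) * (real ?m + 1)) * ?R"
      unfolding G_la x by (simp only: mult_ac)
    also have "\<dots> = ?G mu * (?x mu (p - i) + 1 + real a)"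
      unfolding w G_mu by (simp only: mult_ac)
    finally have G: "?G la * ?x la (p - i) = ?G mu * (?x mu (p - i) + 1 + real a)" .
    have "?V la * ?G la * (?x la (p - i) * ?V mu) = ?G la * ?x la (p - i) * (?V la * ?V mu)"
      by (simp only: mult_ac)
    also have "\<dots> = ?V mu * ?G mu * ((?x mu (p - i) + 1 + real a) * ?V la)"
      unfolding G by (simp only: mult_ac)
    finally have "?V la * ?G la * (?x la (p - i) * ?V mu)
        = ?V mu * ?G mu * ((?x mu (p - i) + 1 + real a) * ?V la)" .
    then show ?case
      by (simp only: b prod.case mu_def[symmetric] x_la x_mu)
  qed
  also have "\<dots> = (\<Sum>la\<in>bounded_partitions p k. ?V la * ?G la * (\<Sum>i\<in>addable p la.
          (?x la (p - i) + 1 + real a) * vandermonde_det p ((?x la)(p - i := ?x la (p - i) + 1))))"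
    by (simp add: sum.Sigma[symmetric] finite_bounded_partitions sum_distrib_left addable_def)
  also have "\<dots> = real (p * (p + a) + k) * cauchy_sum p a k"
    unfolding cauchy_sum_def sum_distrib_left[of "real (p * (p + a) + k)"]
    by (intro sum.cong refl) (simp only: sum_additions, simp add: power2_eq_square)
  finally show ?thesis .
qed

lemma bounded_partitions_0: "bounded_partitions p 0 = {\<lambda>_. 0}"
proof (intro equalityI subsetI)
  fix la assume "la \<in> bounded_partitions p 0"
  from bounded_partitionsD(2,6)[OF this] show "la \<in> {\<lambda>_. 0}"
    by (auto simp: weight_def fun_eq_iff)
next
  fix la :: "nat \<Rightarrow> nat" assume "la \<in> {\<lambda>_. 0}"
  then show "la \<in> bounded_partitions p 0" by (auto intro: bounded_partitionsI)
qed

lemma cauchy_sum_eq: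
  "cauchy_sum p a k = (\<Prod>r<p. fact r * fact (r + a)) * pochhammer (real (p * (p + a))) k / fact k"
proof (induction k)
  case 0
  have "beta_number p (\<lambda>_. 0) = (\<lambda>r. r)" by (simp add: beta_number_def fun_eq_iff)
  then show ?case
    by (simp add: cauchy_sum_def bounded_partitions_0 vandermonde_det_staircase power2_eq_square
        flip: prod.distrib)
next
  case (Suc k)
  have "cauchy_sum p a (Suc k) = real (p * (p + a) + k) * cauchy_sum p a k / real (Suc k)"
    using cauchy_sum_rec[of k p a] by (simp add: field_simps del: of_nat_Suc)
  then show ?case
    by (simp add: Suc pochhammer_Suc mult_ac del: of_nat_Suc of_nat_mult)
qed

section \<open>Stirling's formula\<close>

text \<open>The increments are O(1/n^2), hence summable, and they telescope. The limit is the
  logarithm of Stirling's constant.\<close>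

lemma ln_fact_convergent:
  "\<exists>c. (\<lambda>n. ln (fact (Suc n)) - (real (Suc n) + 1/2) * ln (real (Suc n)) + real (Suc n)) \<longlonglongrightarrow> c"
proof -
  define a :: "nat \<Rightarrow> real"
    where "a n = ln (fact (Suc n)) - (real (Suc n) + 1/2) * ln (real (Suc n)) + real (Suc n)" for n
  have "a (Suc n) - a n = 1 - (real n + 3/2) * ln ((real n + 2) / (real n + 1))" for n
  proof -
    have "fact (Suc (Suc n)) = (real n + 2) * fact (Suc n)" by (simp add: algebra_simps)
    then have "ln (fact (Suc (Suc n))) = ln (real n + 2) + ln (fact (Suc n))"
      by (simp only: ln_mult_pos fact_gt_zero of_nat_0_le_iff add_nonneg_pos zero_less_numeral)
    then show ?thesis
      by (simp add: a_def ln_div algebra_simps del: fact_Suc)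
  qed
  moreover have "(\<lambda>n. 1 - (real n + 3/2) * ln ((real n + 2) / (real n + 1))) \<in> O(\<lambda>n. 1 / real n ^ 2)"
    by real_asymp
  moreover have "summable (\<lambda>n. norm (1 / real n ^ 2))"
    using inverse_power_summable[of 2, where ?'a = real] by (simp add: field_simps)
  ultimately have "summable (\<lambda>n. a (Suc n) - a n)"
    using summable_comparison_test_bigo by (auto cong: summable_cong)
  then have "convergent (\<lambda>n. a n - a 0)"
    by (simp add: summable_iff_convergent sum_lessThan_telescope)
  then have "convergent a" 
    by (simp add: convergent_diff_const_right_iff)
  then show ?thesis unfolding a_def[abs_def] convergent_def .
qed

text \<open>The Wallis product rewritten through the central binomial coefficient, the form in which
  it meets Stirling's formula.\<close>

lemma wallis_fact: "(\<lambda>n. (4 ^ n * fact n ^ 2 / fact (2 * n)) ^ 2 / (2 * real n + 1)) \<longlonglongrightarrow> pi / 2"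
proof -
  have "(\<Prod>k=1..n. (4*real k^2) / (4*real k^2 - 1))
      = (4 ^ n * fact n ^ 2 / fact (2 * n)) ^ 2 / (2 * real n + 1)" for n
  proof (induction n)
    case (Suc n)
    define A :: real where "A = 4 ^ n * fact n ^ 2 / fact (2 * n)"
    have "4 * real (Suc n)^2 - 1 = (2 * real n + 1) * (2 * real n + 3)"
      by (simp add: power2_eq_square algebra_simps)
    moreover have "4 ^ Suc n * fact (Suc n) ^ 2 / fact (2 * Suc n)
        = A * (2 * real (Suc n) / (2 * real n + 1))"
    proof -
      have "fact (2 * Suc n) = 2 * real (Suc n) * (2 * real n + 1) * fact (2 * n)"
        by (simp add: algebra_simps)
      moreover have "fact (Suc n) ^ 2 = real (Suc n) ^ 2 * fact n ^ 2"
        by (simp add: power_mult_distrib del: of_nat_Suc)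
      moreover have "2 * real n + 1 \<noteq> 0" by linarith
      ultimately show ?thesis
        by (simp add: A_def divide_simps power2_eq_square del: of_nat_Suc)
    qed
    moreover have "2 * real n + 1 \<noteq> 0" "2 * real n + 3 \<noteq> 0" by linarith+
    moreover have "2 * real (Suc n) + 1 = 2 * real n + 3" by simp
    moreover have "A\<^sup>2 / y * (4 * m\<^sup>2 / (y * z)) = (A * (2 * m / y))\<^sup>2 / z" for m y z :: real
      by (simp add: power_mult_distrib power_divide) (simp add: power2_eq_square)
    ultimately show ?case
      using Suc by (simp only: A_def[symmetric] prod.nat_ivl_Suc' le_SucI[OF le0]) (simp add: mult.commute)
  qed auto
  then show ?thesis using wallis by simp
qed

text \<open>In \<open>b n ^ 2 / b (2 * n)\<close> the powers of \<open>n / exp 1\<close> cancel. The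
  quotient tends to Stirling's constant \<open>exp c\<close>, while Wallis gives the limit
  \<open>2 * pi\<close> for its square.\<close>

lemma stirling_formula:
  "(\<lambda>n. fact n / (sqrt (2 * pi * real n) * (real n / exp 1) ^ n)) \<longlonglongrightarrow> 1"
proof -
  define b :: "nat \<Rightarrow> real" where "b n = fact n / (sqrt (real n) * (real n / exp 1) ^ n)" for n
  obtain c where c: "(\<lambda>n. ln (fact (Suc n)) - (real (Suc n) + 1/2) * ln (real (Suc n)) + real (Suc n)) \<longlonglongrightarrow> c"
    using ln_fact_convergent by blast
  have "exp (ln (fact (Suc n)) - (real (Suc n) + 1/2) * ln (real (Suc n)) + real (Suc n)) = b (Suc n)" for n
  proof -
    let ?m = "real (Suc n)"
    have "?m powr (?m + 1/2) = ?m ^ Suc n * sqrt ?m"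
      by (simp only: powr_add powr_half_sqrt powr_realpow of_nat_0_less_iff zero_less_Suc of_nat_0_le_iff)
    then have "exp ((?m + 1/2) * ln ?m) = ?m ^ Suc n * sqrt ?m"
      by (simp add: powr_def)
    then show ?thesis
      by (simp add: b_def exp_diff exp_add power_divide exp_of_nat_mult[symmetric] del: power_Suc of_nat_Suc fact_Suc)
  qed
  then have "(\<lambda>n. b (Suc n)) \<longlonglongrightarrow> exp c"
    using tendsto_exp[OF c] by simp
  then have b: "b \<longlonglongrightarrow> exp c" by (rule LIMSEQ_imp_Suc)
  have b2: "(\<lambda>n. b (2 * n)) \<longlonglongrightarrow> exp c"
    by (rule filterlim_compose[OF b]) real_asymp
  have "(\<lambda>n. (b n ^ 2 / b (2 * n)) ^ 2) \<longlonglongrightarrow> (exp c ^ 2 / exp c) ^ 2"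
    by (intro tendsto_intros b b2) auto
  moreover have "(\<lambda>n. (b n ^ 2 / b (2 * n)) ^ 2) \<longlonglongrightarrow> 2 * pi"
  proof -
    have "(\<lambda>n. (4 ^ n * fact n ^ 2 / fact (2 * n)) ^ 2 / (2 * real n + 1) * ((2 * real n + 1) * 2 / real n))
        \<longlonglongrightarrow> pi / 2 * 4"
      by (intro tendsto_mult wallis_fact) real_asymp
    moreover have "\<forall>\<^sub>F n in sequentially.
        (4 ^ n * fact n ^ 2 / fact (2 * n)) ^ 2 / (2 * real n + 1) * ((2 * real n + 1) * 2 / real n)
          = (b n ^ 2 / b (2 * n)) ^ 2"
      using eventually_gt_at_top[of 0]
    proof eventually_elim
      case (elim n)
      have cancel: "u / y * (y * 2 / v) = u * (2 / v)" if "y \<noteq> 0" for u v y :: real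
        using that by simp
      define c where "c = (real n / exp 1) ^ n"
      have c: "c > 0" using elim by (simp add: c_def)
      have "(real (2 * n) / exp 1) ^ (2 * n) = 4 ^ n * c\<^sup>2"
      proof -
        have "(real (2 * n) / exp 1) ^ (2 * n) = ((2 * (real n / exp 1)) ^ n)\<^sup>2"
          by (simp add: mult.commute flip: power_mult)
        also have "\<dots> = (2 * 2) ^ n * c\<^sup>2"
          unfolding power_mult_distrib c_def power2_eq_square by simp
        finally show ?thesis by simp
      qed
      then have b2: "b (2 * n) = fact (2 * n) / (sqrt (2 * real n) * (4 ^ n * c\<^sup>2))"
        by (simp add: b_def)
      have b1: "b n ^ 2 = fact n ^ 2 / (real n * c\<^sup>2)"
        by (simp add: b_def c_def power_divide power_mult_distrib)
      have "(b n ^ 2 / b (2 * n)) ^ 2 =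
          (4 ^ n * fact n ^ 2 / fact (2 * n) * (sqrt (2 * real n) / real n)) ^ 2"
        using c by (simp add: b1 b2) (simp add: mult_ac)
      also have "\<dots> = (4 ^ n * fact n ^ 2 / fact (2 * n)) ^ 2 * (2 / real n)"
        using elim by (simp add: power_mult_distrib power_divide power2_eq_square[of "real n"])
      finally show ?case by (subst cancel) (simp_all add: add_nonneg_eq_0_iff)
    qed
    ultimately show ?thesis by (simp add: tendsto_cong)
  qed
  ultimately have "(exp c ^ 2 / exp c) ^ 2 = 2 * pi" by (rule LIMSEQ_unique)
  then have "exp c ^ 2 = 2 * pi" by (simp add: power2_eq_square)
  then have "exp c = sqrt (2 * pi)" by (metis abs_exp_cancel real_sqrt_abs)
  then have "(\<lambda>n. b n / sqrt (2 * pi)) \<longlonglongrightarrow> 1"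
    using tendsto_divide[OF b tendsto_const[of "sqrt (2 * pi)"]] by simp
  then show ?thesis by (simp add: b_def real_sqrt_mult mult_ac)
qed

section \<open>Moments of the chi-square distribution\<close>

abbreviation std_normal_measure :: "real measure" where
  "std_normal_measure \<equiv> density lborel (\<lambda>x. ennreal (std_normal_density x))"

text \<open>Half the square of a standard normal variable has the Gamma law of shape 1/2, whose
  moments are rising factorials. Nonnegative integrals keep integrability conditions out of the
  induction below.\<close>

lemma nn_integral_std_normal_even:
  "(\<integral>\<^sup>+ y. ennreal ((y\<^sup>2 / 2) ^ j) \<partial>std_normal_measure) = ennreal (pochhammer (1/2) j)"
proof -
  have "(\<integral>\<^sup>+ y. ennreal ((y\<^sup>2 / 2) ^ j) \<partial>std_normal_measure)
      = (\<integral>\<^sup>+ y. ennreal ((1/2) ^ j * (std_normal_density y * y ^ (2 * j))) \<partial>lborel)"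
    by (subst nn_integral_density)
       (auto intro!: nn_integral_cong simp: ennreal_mult'[symmetric] power_mult_distrib
          mult_ac power_divide simp flip: power_mult)
  also have "\<dots> = ennreal ((1/2) ^ j * (fact (2 * j) / (2 ^ j * fact j)))"
    using has_bochner_integral_mult_right[OF std_normal_moment_even[of j], of "(1/2) ^ j"]
    by (subst nn_integral_eq_integral)
       (auto simp: has_bochner_integral_iff intro!: AE_I2 mult_nonneg_nonneg simp: power_mult)
  also have "(1/2) ^ j * (fact (2 * j) / (2 ^ j * fact j)) = pochhammer (1/2 :: real) j"
    by (subst fact_double) (simp add: power_mult power_divide field_simps power2_eq_square flip: power_mult_distrib)
  finally show ?thesis .
qed

lemma product_sigma_finite_std_normal: "product_sigma_finite (\<lambda>_. std_normal_measure)"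
proof -
  interpret prob_space std_normal_measure
    by (rule prob_space_normal_density) simp
  show ?thesis by (simp add: product_sigma_finite_def sigma_finite_measure_axioms)
qed

lemma pochhammer_real_nonneg: "0 \<le> x \<Longrightarrow> 0 \<le> pochhammer (x :: real) k"
  by (simp add: pochhammer_prod prod_nonneg)

text \<open>Split off one coordinate by Tonelli and expand the power binomially; the Vandermonde
  convolution of rising factorials adds the parameters 1/2 and \<open>card J / 2\<close>.\<close>

lemma nn_integral_sum_squares:
  assumes "finite J"
  shows "(\<integral>\<^sup>+ x. ennreal (((\<Sum>i\<in>J. (x i)\<^sup>2) / 2) ^ k) \<partial>(\<Pi>\<^sub>M i\<in>J. std_normal_measure))
    = ennreal (pochhammer (real (card J) / 2) k)"
  using assms
proof (induction J arbitrary: k rule: finite_induct)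
  case empty
  show ?case by (simp add: PiM_empty nn_integral_count_space_finite pochhammer_0_left power_0_left)
next
  case (insert a J)
  interpret product_sigma_finite "\<lambda>i :: 'a. std_normal_measure"
    by (rule product_sigma_finite_std_normal)
  let ?M = "\<lambda>J :: 'a set. \<Pi>\<^sub>M i\<in>J. std_normal_measure"
  have [measurable]: "(\<lambda>x. \<Sum>i\<in>I. (x i)\<^sup>2 :: real) \<in> borel_measurable (?M I)" for I
    by (intro borel_measurable_sum borel_measurable_power) (auto intro!: measurable_component_singleton[THEN measurable_compose])
  have upd: "(\<Sum>i\<in>insert a J. ((x(a := y)) i)\<^sup>2) = y\<^sup>2 + (\<Sum>i\<in>J. (x i)\<^sup>2)" for x and y :: real
    using insert.hyps by (auto intro!: sum.cong)
  have expand: "ennreal (((y\<^sup>2 + s) / 2) ^ k) = (\<Sum>j\<le>k. ennreal (real (k choose j)) *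
      (ennreal ((y\<^sup>2 / 2) ^ j) * ennreal ((s / 2) ^ (k - j))))" if "0 \<le> s" for y s :: real
    using that unfolding add_divide_distrib binomial_ring
    by (simp add: ennreal_mult[symmetric] mult.assoc flip: sum_ennreal)
  have "(\<integral>\<^sup>+ x. ennreal (((\<Sum>i\<in>insert a J. (x i)\<^sup>2) / 2) ^ k) \<partial>(?M (insert a J)))
      = (\<integral>\<^sup>+ y. (\<integral>\<^sup>+ x. ennreal (((y\<^sup>2 + (\<Sum>i\<in>J. (x i)\<^sup>2)) / 2) ^ k) \<partial>(?M J)) \<partial>std_normal_measure)"
    using insert.hyps by (subst product_nn_integral_insert_rev) (simp_all only: upd, measurable)
  also have "\<dots> = (\<integral>\<^sup>+ y. (\<Sum>j\<le>k. ennreal (real (k choose j)) *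
      (ennreal ((y\<^sup>2 / 2) ^ j) * ennreal (pochhammer (real (card J) / 2) (k - j)))) \<partial>std_normal_measure)"
    by (simp add: expand sum_nonneg nn_integral_sum nn_integral_cmult insert.IH cong: nn_integral_cong)
  also have "\<dots> = (\<Sum>j\<le>k. ennreal (real (k choose j)) *
      (ennreal (pochhammer (1/2) j) * ennreal (pochhammer (real (card J) / 2) (k - j))))"
    by (simp add: nn_integral_sum nn_integral_cmult nn_integral_multc nn_integral_std_normal_even)
  also have "\<dots> = ennreal (\<Sum>j\<le>k. real (k choose j) * pochhammer (1/2) j * pochhammer (real (card J) / 2) (k - j))"
    by (simp add: ennreal_mult[symmetric] pochhammer_real_nonneg mult.assoc flip: sum_ennreal)
  also have "\<dots> = ennreal (pochhammer (real (card (insert a J)) / 2) k)"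
    using insert.hyps by (simp add: pochhammer_binomial_sum[symmetric] add_divide_distrib)
  finally show ?case .
qed

lemma chi_square_moment:
  "(LINT z|chi_square m. (1/2 * z) ^ k) = pochhammer (real m / 2) k"
proof -
  let ?P = "\<Pi>\<^sub>M i\<in>{1..m}. std_normal_measure"
  have [measurable]: "(\<lambda>x. \<Sum>i\<in>{1..m}. (x i)\<^sup>2 :: real) \<in> borel_measurable ?P"
    by (intro borel_measurable_sum borel_measurable_power) (auto intro!: measurable_component_singleton[THEN measurable_compose])
  have "(LINT z|chi_square m. (1/2 * z) ^ k) = (LINT x|?P. ((\<Sum>i\<in>{1..m}. (x i)\<^sup>2) / 2) ^ k)"
    unfolding chi_square_def by (subst integral_distr) auto
  also have "\<dots> = enn2real (\<integral>\<^sup>+ x. ennreal (((\<Sum>i\<in>{1..m}. (x i)\<^sup>2) / 2) ^ k) \<partial>?P)"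
    by (intro integral_eq_nn_integral) (auto intro!: AE_I2 zero_le_power simp: sum_nonneg)
  also have "\<dots> = pochhammer (real m / 2) k"
    by (subst nn_integral_sum_squares) (simp_all add: pochhammer_real_nonneg)
  finally show ?thesis .
qed

section \<open>Asymptotics of the expectation\<close>

lemma fact_shift_asymp: "(\<lambda>m. fact (m + c) / (fact m * real m ^ c)) \<longlonglongrightarrow> 1"
proof (induction c)
  case 0
  then show ?case by simp
next
  case (Suc c)
  have "(\<lambda>m. (real m + real c + 1) / real m) \<longlonglongrightarrow> 1"
    by real_asymp
  from tendsto_mult[OF Suc this] show ?case
    by (simp add: add_ac mult_ac)
qed

text \<open>With \<open>N = n - p\<close>, Stirling handles \<open>fact (p * N)\<close> and the
  powers of \<open>fact N\<close>, and the shifts by \<open>k\<close> and \<open>x r\<close>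
  contribute only powers of \<open>N\<close>.\<close>

lemma multinomial_asymp:
  assumes p: "1 \<le> p" and x: "(\<Sum>r<p. x r) = k + (\<Sum>r<p. r)"
  shows "(\<lambda>n. real n powr (((real p)\<^sup>2 - 1) / 2) *
      (fact (p * (n - p) + k) / (real p ^ (p * (n - p) + k) * (\<Prod>r<p. fact (n - p + x r)))))
    \<longlonglongrightarrow> sqrt (real p) / sqrt (2 * pi) ^ (p - 1)"
proof (rule LIMSEQ_offset[where k = p])
  \<comment> \<open>The offset replaces \<open>n\<close> by \<open>N + p\<close>. \<open>S\<close>
    and \<open>R\<close> measure the errors of Stirling's formula and of the shifted factorials, so
    both tend to 1.\<close>
  define e where "e = ((real p)\<^sup>2 - 1) / 2"
  define S where "S N = fact N / (sqrt (2 * pi * real N) * (real N / exp 1) ^ N)" for N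
  define R where "R c m = fact (m + c) / (fact m * real m ^ c)" for c m :: nat
  have pN: "filterlim (\<lambda>N. p * N) at_top sequentially"
    using p by (intro mult_nat_left_at_top) auto
  have "(\<lambda>N. ((real N + real p) / real N) powr e * (S (p * N) / S N ^ p) *
      (R k (p * N) / (\<Prod>r<p. R (x r) N)) * (sqrt (real p) / sqrt (2 * pi) ^ (p - 1)))
      \<longlonglongrightarrow> 1 powr e * (1 / 1 ^ p) * (1 / (\<Prod>r<p. 1)) * (sqrt (real p) / sqrt (2 * pi) ^ (p - 1))"
  proof (intro tendsto_intros)
    show "(\<lambda>N. (real N + real p) / real N) \<longlonglongrightarrow> 1" by real_asymp
    show S: "S \<longlonglongrightarrow> 1" using stirling_formula by (simp add: S_def[abs_def])
    show "(\<lambda>N. S (p * N)) \<longlonglongrightarrow> 1" by (rule filterlim_compose[OF S pN])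
    have R: "R c \<longlonglongrightarrow> 1" for c using fact_shift_asymp by (simp add: R_def[abs_def])
    show "(\<lambda>N. R (x r) N) \<longlonglongrightarrow> 1" for r using R .
    show "(\<lambda>N. R k (p * N)) \<longlonglongrightarrow> 1" by (rule filterlim_compose[OF R pN])
  qed auto
  moreover have "\<forall>\<^sub>F N in sequentially.
      ((real N + real p) / real N) powr e * (S (p * N) / S N ^ p) *
        (R k (p * N) / (\<Prod>r<p. R (x r) N)) * (sqrt (real p) / sqrt (2 * pi) ^ (p - 1))
      = real (N + p) powr e * (fact (p * (N + p - p) + k) /
          (real p ^ (p * (N + p - p) + k) * (\<Prod>r<p. fact (N + p - p + x r))))"
    using eventually_gt_at_top[of 0]
  proof eventually_elim
    case (elim N)
    define s where "s = sqrt (2 * pi * real N)"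
    define c where "c = (real N / exp 1) ^ N"
    have pos: "0 < s" "0 < c" "0 < real N" "0 < real p" using elim p by (auto simp: s_def c_def)
    \<comment> \<open>The square roots come from Stirling: \<open>p\<close> in the denominator
      against one in the numerator. The remaining power comes from the shifts \<open>x r\<close>,
      after \<open>k\<close> cancels.\<close>
    have "real N powr e = sqrt (real N) ^ (p - 1) * real N ^ (\<Sum>r<p. r)"
    proof -
      have "2 * real (\<Sum>r<p. r) = real p * real p - real p"
        by (induction p) (simp_all add: algebra_simps)
      then have e: "e = (1/2) * real (p - 1) + real (\<Sum>r<p. r)"
        using p by (simp add: e_def power2_eq_square of_nat_diff field_simps)
      have "sqrt (real N) ^ (p - 1) = real N powr ((1/2) * real (p - 1))"
        using elim by (simp only: powr_powr[symmetric] powr_half_sqrt of_nat_0_le_iff)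
          (simp add: powr_realpow)
      then show ?thesis
        using elim by (simp add: e powr_add powr_realpow del: of_nat_sum)
    qed
    moreover have "s ^ p = s * (sqrt (2 * pi) ^ (p - 1) * sqrt (real N) ^ (p - 1))"
    proof -
      have "s ^ p = s * s ^ (p - 1)" using p by (cases p) simp_all
      then show ?thesis by (simp add: s_def real_sqrt_mult power_mult_distrib)
    qed
    moreover have "S (p * N) = fact (p * N) / (sqrt (real p) * s * (real p ^ (p * N) * c ^ p))"
    proof -
      have "real (p * N) / exp 1 = real p * (real N / exp 1)" by simp
      then have "(real (p * N) / exp 1) ^ (p * N) = real p ^ (p * N) * c ^ p"
        by (simp only: power_mult_distrib c_def power_mult[symmetric] mult.commute[of N p])
      moreover have "sqrt (2 * pi * real (p * N)) = sqrt (real p) * s"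
        by (simp add: s_def real_sqrt_mult)
      ultimately show ?thesis by (simp only: S_def)
    qed
    moreover have "S N ^ p = fact N ^ p / (s ^ p * c ^ p)"
      unfolding S_def s_def[symmetric] c_def[symmetric] by (simp only: power_mult_distrib power_divide)
    moreover have "R k (p * N) = fact (p * N + k) / (fact (p * N) * (real p ^ k * real N ^ k))"
      by (simp add: R_def power_mult_distrib)
    moreover have "(\<Prod>r<p. R (x r) N)
        = (\<Prod>r<p. fact (N + x r)) / (fact N ^ p * (real N ^ k * real N ^ (\<Sum>r<p. r)))"
      by (simp add: R_def prod_dividef prod.distrib x power_add flip: power_sum)
    moreover have "((real N + real p) / real N) powr e = real (N + p) powr e / real N powr e"
      by (simp add: powr_divide)
    \<comment> \<open>The cancellation is proved for abstract reals, so that simplification does not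
      reopen the factorials and powers.\<close>
    moreover have "X / (u * ns) * (A / (sp * s * (pp * cp)) / (F / (s * (t * u) * cp))) *
        (B / (A * (pk * nk)) / (P / (F * (nk * ns)))) * (sp / t) = X * (B / (pp * pk * P))"
      if "u \<noteq> 0" "ns \<noteq> 0" "A \<noteq> 0" "sp \<noteq> 0" "s \<noteq> 0" "cp \<noteq> 0" "F \<noteq> 0" "t \<noteq> 0"
        "nk \<noteq> 0" for X u ns A sp s pp cp F t B pk nk P :: real
      using that by (simp add: divide_simps)
    ultimately show ?case
      using pos by (simp only: power_add add_diff_cancel_right') simp
  qed
  ultimately show "(\<lambda>N. real (N + p) powr (((real p)\<^sup>2 - 1) / 2) * (fact (p * (N + p - p) + k) /
        (real p ^ (p * (N + p - p) + k) * (\<Prod>r<p. fact (N + p - p + x r)))))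
      \<longlonglongrightarrow> sqrt (real p) / sqrt (2 * pi) ^ (p - 1)"
    by (simp add: tendsto_cong flip: e_def)
qed

section \<open>Partitions containing the rectangle\<close>

lemma prod_shift_fact: "(\<Prod>s<a. real (m + s + 1)) = fact (m + a) / fact m"
proof (induction a)
  case (Suc a)
  have "fact (m + Suc a) = fact (m + a) * real (m + a + 1)" by (simp add: algebra_simps)
  then show ?case by (simp only: prod.lessThan_Suc Suc) simp
qed simp

lemma add_rectangle:
  assumes la: "la \<in> bounded_partitions p k"
  shows "(\<lambda>i. la i + rectangle p N i) \<in> bounded_partitions p (p * N + k)"
proof -
  note D = bounded_partitionsD[OF la]
  have "(\<Sum>i\<in>{1..p}. la i) = k" using weight_eq_sum[of la p] D by simp
  then show ?thesis
    using D(3-5) by (intro bounded_partitionsI) (auto simp: rectangle_def sum.distrib intro!: add_mono)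
qed

lemma sub_rectangle:
  assumes la: "la \<in> bounded_partitions p (p * N + k)" and sub: "rectangle p N \<le> la"
  shows "(\<lambda>i. la i - rectangle p N i) \<in> bounded_partitions p k"
proof (rule bounded_partitionsI)
  note D = bounded_partitionsD[OF la]
  have N: "N \<le> la i" if "1 \<le> i" "i \<le> p" for i
    using sub that by (auto simp: le_fun_def rectangle_def split: if_splits)
  have "(\<Sum>i\<in>{1..p}. la i) = p * N + k" using weight_eq_sum[of la p] D by simp
  moreover have "(\<Sum>i\<in>{1..p}. la i) = (\<Sum>i\<in>{1..p}. (la i - rectangle p N i) + N)"
    using N by (intro sum.cong) (auto simp: rectangle_def)
  ultimately show "(\<Sum>i\<in>{1..p}. la i - rectangle p N i) = k" by (simp add: sum.distrib)
  fix i j :: nat assume ij: "1 \<le> i" "i \<le> j"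
  then show "la j - rectangle p N j \<le> la i - rectangle p N i"
    using D(4)[of j] D(5)[of i j] by (cases "j \<le> p") (auto simp: rectangle_def diff_le_mono)
qed (use bounded_partitionsD[OF la] in auto)

lemma bij_betw_add_rectangle:
  "bij_betw (\<lambda>la i. la i + rectangle p N i) (bounded_partitions p k)
     {la \<in> bounded_partitions p (p * N + k). rectangle p N \<le> la}"
  by (rule bij_betw_byWitness[where f' = "\<lambda>la i. la i - rectangle p N i"])
     (auto simp: add_rectangle sub_rectangle le_fun_def fun_eq_iff)

lemma beta_number_add_rectangle:
  "r < p \<Longrightarrow> beta_number p (\<lambda>i. la i + rectangle p N i) r = N + beta_number p la r"
  by (simp add: beta_number_def rectangle_def)

text \<open>Each tableau count contributes one Vandermonde determinant, which ignores the shift by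
  \<open>N\<close>. Hence \<open>N\<close> survives only in the multinomial factor.\<close>

lemma shape_prob_add_rectangle:
  assumes la: "la \<in> bounded_partitions p k"
  shows "shape_prob (p * N + k) p (\<lambda>i. la i + rectangle p N i)
    = fact (p * N + k) / (real p ^ (p * N + k) * (\<Prod>r<p. fact (N + beta_number p la r)))
      * ((vandermonde_det p (\<lambda>r. real (beta_number p la r)))\<^sup>2 / (\<Prod>j<p. fact j))"
proof -
  let ?la = "\<lambda>i. la i + rectangle p N i"
  have V: "vandermonde_det p (\<lambda>r. real (beta_number p ?la r)) = vandermonde_det p (\<lambda>r. real (beta_number p la r))"
  proof -
    have "vandermonde_det p (\<lambda>r. real (beta_number p ?la r))
        = vandermonde_det p (\<lambda>r. real (beta_number p la r) + real N)"
      by (rule vandermonde_det_cong) (simp add: beta_number_add_rectangle)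
    then show ?thesis by (simp only: vandermonde_det_shift)
  qed
  have "(\<Prod>r<p. fact (beta_number p ?la r)) = (\<Prod>r<p. fact (N + beta_number p la r) :: real)"
    by (intro prod.cong) (simp_all add: beta_number_add_rectangle)
  moreover have "(\<Prod>r<p. fact (N + beta_number p la r) :: real) > 0" by (intro prod_pos) auto
  ultimately have "real (card (standard_tableaux ?la))
      = fact (p * N + k) * vandermonde_det p (\<lambda>r. real (beta_number p la r)) / (\<Prod>r<p. fact (N + beta_number p la r))"
    using card_standard_tableaux[OF add_rectangle[OF la, of N]] by (simp add: V nonzero_eq_divide_eq)
  then show ?thesis
    unfolding shape_prob_def schur_ones card_semistandard_tableaux[OF add_rectangle[OF la]] V
    by (simp add: power2_eq_square) (simp add: mult_ac)
qed

text \<open>All columns in question have height exactly \<open>p\<close>, so the hook length in row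
  \<open>p - r\<close> and column \<open>j\<close> is
  \<open>beta_number p la r + (N - j) + 1\<close>; along a row these are consecutive
  integers.\<close>

lemma hook_product_add_rectangle:
  assumes la: "la \<in> bounded_partitions p k" and a: "a \<le> N" and p: "1 \<le> p"
  defines "mu \<equiv> \<lambda>i. la i + rectangle p N i"
  shows "(\<Prod>(i, j) | (i, j) \<in> diagram mu \<and> N - a < j \<and> j \<le> N. real_of_int (hook mu (i, j)))
    = (\<Prod>r<p. fact (beta_number p la r + a) / fact (beta_number p la r))"
proof -
  note D = bounded_partitionsD[OF la]
  have mu: "mu i = (if 1 \<le> i \<and> i \<le> p then la i + N else 0)" for i
    using D(3,4) by (auto simp: mu_def rectangle_def not_le Suc_le_eq)
  have set: "{(i, j). (i, j) \<in> diagram mu \<and> N - a < j \<and> j \<le> N} = {1..p} \<times> {N - a<..N}"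
    by (auto simp: diagram_def mu split: if_splits)
  have conj: "conj_part mu j = p" if "j \<in> {N - a<..N}" for j
  proof -
    have "{i. 1 \<le> i \<and> j \<le> mu i} = {1..p}" using that by (auto simp: mu)
    then show ?thesis using that by (simp add: conj_part_def)
  qed
  have "(\<Prod>j\<in>{N - a<..N}. real_of_int (hook mu (p - r, j)))
      = fact (beta_number p la r + a) / fact (beta_number p la r)" if r: "r < p" for r
  proof -
    have "(\<Prod>j\<in>{N - a<..N}. real_of_int (hook mu (p - r, j)))
        = (\<Prod>s<a. real (beta_number p la r + s + 1))"
    proof (rule prod.reindex_bij_witness[where i = "\<lambda>s. N - s" and j = "\<lambda>j. N - j"], goal_cases)
      case (5 j)
      then show ?case using r conj[of j]
        by (simp add: hook_def mu beta_number_def of_nat_diff)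
    qed (use a in auto)
    then show ?thesis by (simp only: prod_shift_fact)
  qed
  then have "(\<Prod>i\<in>{1..p}. \<Prod>j\<in>{N - a<..N}. real_of_int (hook mu (i, j)))
      = (\<Prod>r<p. fact (beta_number p la r + a) / fact (beta_number p la r))"
    by (subst prod_reverse[symmetric]) simp
  then show ?thesis
    unfolding set by (simp add: prod.cartesian_product)
qed

lemma hook_expectation_eq:
  assumes p: "1 \<le> p" and q: "p \<le> q" and n: "q \<le> n"
  shows "hook_expectation p q k n = (\<Sum>la\<in>bounded_partitions p k.
    fact (p * (n - p) + k) / (real p ^ (p * (n - p) + k) * (\<Prod>r<p. fact (n - p + beta_number p la r)))
      * ((vandermonde_det p (\<lambda>r. real (beta_number p la r)))\<^sup>2 / (\<Prod>j<p. fact j)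
      * (\<Prod>r<p. fact (beta_number p la r + (q - p)) / fact (beta_number p la r))))"
proof -
  let ?N = "n - p"
  define H where "H la = (\<Prod>(i, j) | (i, j) \<in> diagram la \<and> n - q < j \<and> j \<le> n - p. real_of_int (hook la (i, j)))"
    for la
  have "hook_expectation p q k n
      = (\<Sum>la\<in>partitions_of (p * ?N + k). shape_prob (p * ?N + k) p la *
          (indicator {la. rectangle p ?N \<le> la} la * H la))"
    by (simp add: hook_expectation_def shape_expectation_eq_sum H_def)
  also have "\<dots> = (\<Sum>la\<in>{la \<in> bounded_partitions p (p * ?N + k). rectangle p ?N \<le> la}.
      shape_prob (p * ?N + k) p la * H la)"
  proof (rule sum.mono_neutral_cong_right)
    show "\<forall>la\<in>partitions_of (p * ?N + k) - {la \<in> bounded_partitions p (p * ?N + k). rectangle p ?N \<le> la}.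
        shape_prob (p * ?N + k) p la * (indicator {la. rectangle p ?N \<le> la} la * H la) = 0"
    proof
      fix la assume *: "la \<in> partitions_of (p * ?N + k) - {la \<in> bounded_partitions p (p * ?N + k). rectangle p ?N \<le> la}"
      show "shape_prob (p * ?N + k) p la * (indicator {la. rectangle p ?N \<le> la} la * H la) = 0"
      proof (cases "rectangle p ?N \<le> la")
        case True
        \<comment> \<open>Containing the rectangle but not being bounded means having a part beyond
          row \<open>p\<close>; then no semistandard tableau exists and the probability is
          0.\<close>
        then obtain i where "i > p" "la i \<noteq> 0" using * by (auto simp: bounded_partitions_def)
        then have "semistandard_tableaux la p = {}"
          using * by (intro semistandard_tableaux_empty) (auto simp: partitions_of_def)
        then show ?thesis by (simp add: shape_prob_def schur_ones)
      qed simp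
    qed
  qed (auto simp: finite_partitions_of bounded_partitions_def)
  also have "\<dots> = (\<Sum>la\<in>bounded_partitions p k. shape_prob (p * ?N + k) p (\<lambda>i. la i + rectangle p ?N i)
      * H (\<lambda>i. la i + rectangle p ?N i))"
    by (rule sum.reindex_bij_betw[OF bij_betw_add_rectangle, symmetric])
  also have "\<dots> = (\<Sum>la\<in>bounded_partitions p k.
    fact (p * (n - p) + k) / (real p ^ (p * (n - p) + k) * (\<Prod>r<p. fact (n - p + beta_number p la r)))
      * ((vandermonde_det p (\<lambda>r. real (beta_number p la r)))\<^sup>2 / (\<Prod>j<p. fact j)
      * (\<Prod>r<p. fact (beta_number p la r + (q - p)) / fact (beta_number p la r))))"
  proof (rule sum.cong[OF refl])
    fix la assume la: "la \<in> bounded_partitions p k"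
    have "n - q = ?N - (q - p)" using q by simp
    then have "H (\<lambda>i. la i + rectangle p ?N i)
        = (\<Prod>r<p. fact (beta_number p la r + (q - p)) / fact (beta_number p la r))"
      using hook_product_add_rectangle[OF la _ p, of "q - p" ?N] n q by (simp add: H_def)
    then show "shape_prob (p * ?N + k) p (\<lambda>i. la i + rectangle p ?N i) * H (\<lambda>i. la i + rectangle p ?N i)
      = fact (p * (n - p) + k) / (real p ^ (p * (n - p) + k) * (\<Prod>r<p. fact (n - p + beta_number p la r)))
      * ((vandermonde_det p (\<lambda>r. real (beta_number p la r)))\<^sup>2 / (\<Prod>j<p. fact j)
      * (\<Prod>r<p. fact (beta_number p la r + (q - p)) / fact (beta_number p la r)))"
      by (simp only: shape_prob_add_rectangle[OF la] mult.assoc)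
  qed
  finally show ?thesis .
qed

section \<open>Assembling the limit\<close>

lemma pochhammer_over_fact: "1 \<le> m \<Longrightarrow> pochhammer (real m) k / fact k = real ((m - 1 + k) choose k)"
  by (simp add: binomial_gbinomial gbinomial_pochhammer' of_nat_diff)

theorem theorem1p2:
  fixes p q k :: nat
  assumes "1 \<le> p" and "p \<le> q"
  shows "((\<lambda>n. real n powr (((real p)\<^sup>2 - 1) / 2) * hook_expectation p q k n) \<longlonglongrightarrow>
           sqrt (real p) * (\<Prod>j=1..p. fact (q - j)) / (sqrt (2 * pi) ^ (p - 1) * fact k)
             * (LINT z|chi_square (2 * p * q). (1 / 2 * z) ^ k))
       \<and> hook_expectation p q k \<sim>[sequentially]
           (\<lambda>n. (sqrt (real p) * (\<Prod>j=1..p. fact (q - j)) / sqrt (2 * pi) ^ (p - 1)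
                  * real ((p * q - 1 + k) choose k))
                * real n powr (- (((real p)\<^sup>2 - 1) / 2)))"
proof -
  define e where "e = ((real p)\<^sup>2 - 1) / 2"
  \<comment> \<open>The binomial form of the constant. The moment form reduces to it since
    \<open>2 * p * q / 2 = p * q\<close> and a rising factorial over \<open>fact k\<close> is a
    binomial coefficient.\<close>
  define C where "C = sqrt (real p) * (\<Prod>j=1..p. fact (q - j)) / sqrt (2 * pi) ^ (p - 1)
    * real ((p * q - 1 + k) choose k)"
  let ?c = "\<lambda>la. (vandermonde_det p (\<lambda>r. real (beta_number p la r)))\<^sup>2 / (\<Prod>j<p. fact j)
      * (\<Prod>r<p. fact (beta_number p la r + (q - p)) / fact (beta_number p la r))"
  let ?L = "sqrt (real p) / sqrt (2 * pi) ^ (p - 1)"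
  have "1 * 1 \<le> p * q" using assms by (intro mult_le_mono) auto
  then have pq: "1 \<le> p * q" by simp
  \<comment> \<open>The index set does not depend on \<open>n\<close>, so the limit is taken term by
    term.\<close>
  have lim0: "(\<lambda>n. \<Sum>la\<in>bounded_partitions p k. real n powr e *
      (fact (p * (n - p) + k) / (real p ^ (p * (n - p) + k) * (\<Prod>r<p. fact (n - p + beta_number p la r)))) * ?c la)
      \<longlonglongrightarrow> (\<Sum>la\<in>bounded_partitions p k. ?L * ?c la)"
    unfolding e_def
    by (intro tendsto_sum tendsto_mult_right multinomial_asymp assms sum_beta_number)
  have ev: "\<forall>\<^sub>F n in sequentially. (\<Sum>la\<in>bounded_partitions p k. real n powr e *
      (fact (p * (n - p) + k) / (real p ^ (p * (n - p) + k) * (\<Prod>r<p. fact (n - p + beta_number p la r)))) * ?c la)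
      = real n powr e * hook_expectation p q k n"
    using eventually_ge_at_top[of q]
    by eventually_elim (simp add: hook_expectation_eq[OF assms] sum_distrib_left mult.assoc)
  have sum_C: "(\<Sum>la\<in>bounded_partitions p k. ?L * ?c la) = C"
  proof -
    have "(\<Sum>la\<in>bounded_partitions p k. ?L * ?c la) = ?L * (cauchy_sum p (q - p) k / (\<Prod>j<p. fact j))"
      by (simp add: cauchy_sum_def sum_distrib_left sum_divide_distrib)
    also have "cauchy_sum p (q - p) k / (\<Prod>j<p. fact j)
        = (\<Prod>r<p. fact (r + (q - p))) * (pochhammer (real (p * q)) k / fact k)"
      using assms by (simp add: cauchy_sum_eq prod.distrib prod_zero_iff)
    \<comment> \<open>The substitution \<open>j = p - r\<close> turns \<open>r + (q - p)\<close>
      into \<open>q - j\<close>.\<close>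
    also have "(\<Prod>r<p. fact (r + (q - p))) = (\<Prod>r<p. fact (q - (p - r)) :: real)"
      using assms by (intro prod.cong refl arg_cong[where f = fact]) auto
    also have "\<dots> = (\<Prod>j=1..p. fact (q - j))"
      by (rule prod_reverse)
    finally show ?thesis
      unfolding C_def pochhammer_over_fact[OF pq, symmetric] by simp
  qed
  have lim: "(\<lambda>n. real n powr e * hook_expectation p q k n) \<longlonglongrightarrow> C"
    by (rule Lim_transform_eventually[OF lim0[unfolded sum_C] ev])
  have moment: "sqrt (real p) * (\<Prod>j=1..p. fact (q - j)) / (sqrt (2 * pi) ^ (p - 1) * fact k)
      * (LINT z|chi_square (2 * p * q). (1 / 2 * z) ^ k) = C"
    unfolding chi_square_moment C_def pochhammer_over_fact[OF pq, symmetric] by simp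
  have equiv: "hook_expectation p q k \<sim>[sequentially] (\<lambda>n. C * real n powr (- e))"
  proof (rule asymp_equivI')
    have "C \<noteq> 0" using assms pq by (simp add: C_def prod_zero_iff binomial_eq_0_iff not_less del: One_nat_def)
    then have "(\<lambda>n. real n powr e * hook_expectation p q k n / C) \<longlonglongrightarrow> 1"
      using tendsto_divide[OF lim tendsto_const[of C]] by simp
    moreover have "\<forall>\<^sub>F n in sequentially. real n powr e * hook_expectation p q k n / C
        = hook_expectation p q k n / (C * real n powr (- e))"
      using eventually_gt_at_top[of 0] by eventually_elim (simp add: powr_minus field_simps)
    ultimately show "(\<lambda>n. hook_expectation p q k n / (C * real n powr (- e))) \<longlonglongrightarrow> 1"
      by (simp add: tendsto_cong)
  qed
  show ?thesis
    using lim equiv by (simp only: moment C_def[symmetric] e_def[symmetric] simp_thms)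
qed

end
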